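(* Let $G$ be a Polish group. Then: (1) $G$ is a discrete countable group containing at least two elements if and only if $E(G)\sim_B E_0$; (2) if $G$ is TSI, uncountable and non-archimedean, then $E(G)\sim_B E_0^\omega$; (3) $G$ is non-archimedean if and only if $E(G)\le_B {=^+}$.
   Context: For a Polish group $G$, $E(G)$ is the equivalence relation on $G^\omega$ defined by $x\,E(G)\,y$ iff the sequence $(x(n)y(n)^{-1})_{n}$ converges in $G$. $\le_B$ denotes Borel reducibility, $E\sim_B F$ means $E\le_B F$ and $F\le_B E$. $E_0$ is the equivalence relation on $2^\omega$ given by $x E_0 y$ iff $\exists m\,\forall n>m\,(x(n)=y(n))$. For an equivalence relation $E$ on a Polish space $X$, $E^\omega$ on $X^\omega$ is $(x_n)E^\omega(y_n)$ iff $\forall n\,(x_nEy_n)$, and $E^+$ on $X^\omega$ is $(x_n)E^+(y_n)$ iff $\forall n\exists m\,(x_nEy_m)$ and $\forall m\exists n\,(x_nEy_m)$; $=^+$ denotes $\mathrm{id}(\omega^\omega)^+$. A Polish group is non-archimedean if it has a neighborhood base of the identity consisting of open subgroups, and TSI if it admits a compatible two-sided invariant metric. *)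

theory Defs
  imports "HOL-Analysis.Analysis"
begin

text \<open>
  A Polish group is a type of sort \<open>{topological_group_add, polish_space}\<close>.  The class
  \<open>group_add\<close> does not assume commutativity, so this is only additive notation for an arbitrary
  group: \<open>x + y\<close>, \<open>- x\<close>, \<open>0\<close> and \<open>x - y = x + (- y)\<close> stand for $xy$, $x^{-1}$, $1$ and $xy^{-1}$.
  The class \<open>polish_space\<close> carries some complete metric inducing the topology; nothing below
  refers to that metric, only to the topology.

  A relation on a Polish space is a binary predicate on the type; $X^\omega$ is
  \<open>nat \<Rightarrow> 'x\<close> with the product topology, and $2^\omega$ and $\omega^\omega$ are
  \<open>nat \<Rightarrow> bool\<close> and \<open>nat \<Rightarrow> nat\<close>, where \<open>bool\<close> and \<open>nat\<close> are discrete.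
\<close>

definition borel_reducible ::
  "('x::topological_space \<Rightarrow> 'x \<Rightarrow> bool) \<Rightarrow> ('y::topological_space \<Rightarrow> 'y \<Rightarrow> bool) \<Rightarrow> bool"
  (infix \<open>\<le>\<^sub>B\<close> 50)
  where "E \<le>\<^sub>B F \<longleftrightarrow>
    (\<exists>f \<in> measurable (borel :: 'x measure) (borel :: 'y measure). \<forall>x y. E x y \<longleftrightarrow> F (f x) (f y))"

definition borel_bireducible ::
  "('x::topological_space \<Rightarrow> 'x \<Rightarrow> bool) \<Rightarrow> ('y::topological_space \<Rightarrow> 'y \<Rightarrow> bool) \<Rightarrow> bool"
  (infix \<open>\<sim>\<^sub>B\<close> 50)
  where "E \<sim>\<^sub>B F \<longleftrightarrow> E \<le>\<^sub>B F \<and> F \<le>\<^sub>B E"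

definition group_equiv ::
  "'a::topological_group_add itself \<Rightarrow> (nat \<Rightarrow> 'a) \<Rightarrow> (nat \<Rightarrow> 'a) \<Rightarrow> bool"
  where "group_equiv _ x y \<longleftrightarrow> convergent (\<lambda>n. x n - y n)"

definition E0 :: "(nat \<Rightarrow> bool) \<Rightarrow> (nat \<Rightarrow> bool) \<Rightarrow> bool"
  where "E0 x y \<longleftrightarrow> (\<exists>m. \<forall>n>m. x n = y n)"

definition omega_power :: "('x \<Rightarrow> 'x \<Rightarrow> bool) \<Rightarrow> (nat \<Rightarrow> 'x) \<Rightarrow> (nat \<Rightarrow> 'x) \<Rightarrow> bool"
  where "omega_power E x y \<longleftrightarrow> (\<forall>n. E (x n) (y n))"

definition plus_jump :: "('x \<Rightarrow> 'x \<Rightarrow> bool) \<Rightarrow> (nat \<Rightarrow> 'x) \<Rightarrow> (nat \<Rightarrow> 'x) \<Rightarrow> bool"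
  where "plus_jump E x y \<longleftrightarrow> (\<forall>n. \<exists>m. E (x n) (y m)) \<and> (\<forall>m. \<exists>n. E (x n) (y m))"

definition eq_plus :: "(nat \<Rightarrow> nat \<Rightarrow> nat) \<Rightarrow> (nat \<Rightarrow> nat \<Rightarrow> nat) \<Rightarrow> bool"
  where "eq_plus = plus_jump ((=) :: (nat \<Rightarrow> nat) \<Rightarrow> (nat \<Rightarrow> nat) \<Rightarrow> bool)"

definition add_subgroup :: "'a::group_add set \<Rightarrow> bool"
  where "add_subgroup H \<longleftrightarrow>
    0 \<in> H \<and> (\<forall>x\<in>H. \<forall>y\<in>H. x + y \<in> H) \<and> (\<forall>x\<in>H. - x \<in> H)"

definition non_archimedean :: "'a::topological_group_add itself \<Rightarrow> bool"
  where "non_archimedean _ \<longleftrightarrow>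
    (\<forall>U::'a set. open U \<and> 0 \<in> U \<longrightarrow> (\<exists>H. open H \<and> add_subgroup H \<and> H \<subseteq> U))"

definition TSI :: "'a::topological_group_add itself \<Rightarrow> bool"
  where "TSI _ \<longleftrightarrow>
    (\<exists>d :: 'a \<Rightarrow> 'a \<Rightarrow> real.
      Metric_space UNIV d \<and> Metric_space.mtopology UNIV d = euclidean \<and>
      (\<forall>g h x y. d (g + x + h) (g + y + h) = d x y))"

definition discrete_space :: "'a::topological_space itself \<Rightarrow> bool"
  where "discrete_space _ \<longleftrightarrow> (\<forall>S::'a set. open S)"

end

theory Submission
  imports Defs
begin

text \<open>
  Upper bounds. For an open normal subgroup \<open>N\<close>, the sequence \<open>x n - y n\<close> is eventually constant
  modulo \<open>N\<close> iff \<open>- x n + x (n + 1)\<close> and \<open>- y n + y (n + 1)\<close> eventually agree modulo \<open>N\<close>; the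
  graphs of these coset sequences turn this into an instance of \<open>E0\<close>. For an arbitrary open
  subgroup \<open>H\<close> one records instead all finite modifications of the sequences of cosets
  \<open>H + h + x n\<close>, a countable set. In both cases the invariants say that \<open>x n - y n\<close> is Cauchy for
  both one-sided uniformities, and such a sequence \<open>w\<close> converges in a Polish group: for generic
  \<open>u\<close> the translate \<open>w n + u\<close> is Cauchy for the complete metric.

  Lower bounds. If \<open>G\<close> is not discrete, a null sequence of nonzero elements embeds \<open>E0\<^sup>\<omega>\<close> into
  \<open>E(G)\<close>. It is not reducible to \<open>E0\<close>: on a suitable product set a Borel reduction becomes
  continuous, but the classes of \<open>E0\<^sup>\<omega>\<close> are not countable unions of closed sets. If \<open>G\<close> is not
  non-archimedean, there are finite chains from \<open>0\<close> to the complement of a fixed neighbourhood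
  whose steps are arbitrarily small. A sequence of such chains yields a relation on \<open>\<omega>\<^sup>\<omega>\<close> that
  identifies \<open>x\<close> with \<open>x + e\<close> for all \<open>0\<close>-\<open>1\<close> sequences \<open>e\<close>. As for turbulent actions, every
  homomorphism from it to \<open>=\<^sup>+\<close> is constant on a comeager set, although a comeager set contains two
  sequences that sit at opposite ends of infinitely many chains.
\<close>

section \<open>Category on Baire space\<close>

definition comeager :: "'a::topological_space set \<Rightarrow> bool"
  where "comeager S \<longleftrightarrow>
    (\<exists>D::nat \<Rightarrow> 'a set. (\<forall>n. open (D n) \<and> closure (D n) = UNIV) \<and> (\<Inter>n. D n) \<subseteq> S)"

lemma comeager_mono: "comeager S \<Longrightarrow> S \<subseteq> T \<Longrightarrow> comeager T"
  unfolding comeager_def by (meson order_trans)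

lemma comeager_open_dense: "open U \<Longrightarrow> closure U = UNIV \<Longrightarrow> comeager U"
  unfolding comeager_def by (intro exI[of _ "\<lambda>_. U"]) auto

lemma comeager_INT:
  assumes "\<And>n::nat. comeager (S n)"
  shows "comeager (\<Inter>n. S n)"
proof -
  have "\<forall>n. \<exists>D::nat \<Rightarrow> 'a set. (\<forall>k. open (D k) \<and> closure (D k) = UNIV) \<and> (\<Inter>k. D k) \<subseteq> S n"
    using assms unfolding comeager_def by blast
  from choice[OF this] obtain D where D: "\<And>n k::nat. open (D n k) \<and> closure (D n k) = (UNIV::'a set)"
      "\<And>n. (\<Inter>k. D n k) \<subseteq> S n"
    by blast
  have "(\<Inter>m. case_prod D (prod_decode m)) \<subseteq> (\<Inter>n. S n)"
  proof
    fix x assume x: "x \<in> (\<Inter>m. case_prod D (prod_decode m))"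
    have "x \<in> D n k" for n k
      using INT_D[OF x, of "prod_encode (n, k)"] by simp
    then show "x \<in> (\<Inter>n. S n)" using D(2) by blast
  qed
  moreover have "open (case_prod D (prod_decode m)) \<and> closure (case_prod D (prod_decode m)) = UNIV" for m
    using D(1) by (simp split: prod.split)
  ultimately show ?thesis
    unfolding comeager_def by (intro exI[of _ "\<lambda>m. case_prod D (prod_decode m)"]) auto
qed

lemma comeager_Int:
  assumes "comeager S" "comeager T"
  shows "comeager (S \<inter> T)"
proof -
  have "comeager (\<Inter>n. if n = (0::nat) then S else T)"
    by (intro comeager_INT) (use assms in auto)
  then show ?thesis
  proof (rule comeager_mono)
    show "(\<Inter>n. if n = (0::nat) then S else T) \<subseteq> S \<inter> T"
      using INT_lower[of "0::nat" UNIV "\<lambda>n. if n = 0 then S else T"]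
        INT_lower[of "1::nat" UNIV "\<lambda>n. if n = 0 then S else T"] by simp
  qed
qed

lemma comeager_countable_INT:
  assumes "countable I" "\<And>i. i \<in> I \<Longrightarrow> comeager (S i)"
  shows "comeager (\<Inter>i\<in>I. S i)"
proof (cases "I = {}")
  case True
  then show ?thesis by (simp add: comeager_open_dense)
next
  case False
  then have "(\<Inter>i\<in>I. S i) = (\<Inter>n. S (from_nat_into I n))"
    using assms(1) by (metis image_image range_from_nat_into)
  then show ?thesis
    using comeager_INT[of "\<lambda>n. S (from_nat_into I n)"] assms(2) False
    by (simp add: from_nat_into)
qed

text \<open>The sets that agree with some open set on a comeager set form a sigma-algebra in any
  topological space: a complement is handled by removing the nowhere dense boundary, a countable
  union by intersecting comeager sets.\<close>

lemma borel_almost_open: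
  fixes B :: "'a::topological_space set"
  assumes "B \<in> sets borel"
  shows "\<exists>U. open U \<and> comeager {x. x \<in> B \<longleftrightarrow> x \<in> U}"
proof -
  have "B \<in> sigma_sets UNIV {S. open S}"
    using assms by (simp add: borel_def)
  then show ?thesis
  proof (induction rule: sigma_sets.induct)
    case (Basic a)
    then show ?case by (intro exI[of _ a]) (simp add: comeager_open_dense)
  next
    case Empty
    show ?case by (intro exI[of _ "{}"]) (simp add: comeager_open_dense)
  next
    case (Compl a)
    then obtain U where U: "open U" "comeager {x. x \<in> a \<longleftrightarrow> x \<in> U}" by blast
    have "closure (U \<union> - closure U) = UNIV"
      using closure_subset[of "- closure U"] by (auto simp: closure_Un)
    then have "comeager (U \<union> - closure U)"
      using U(1) by (intro comeager_open_dense) auto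
    then have "comeager ({x. x \<in> a \<longleftrightarrow> x \<in> U} \<inter> (U \<union> - closure U))"
      using U(2) by (rule comeager_Int[rotated])
    then have "comeager {x. x \<in> UNIV - a \<longleftrightarrow> x \<in> - closure U}"
      by (rule comeager_mono) (use closure_subset[of U] in auto)
    then show ?case by (intro exI[of _ "- closure U"]) auto
  next
    case (Union a)
    then obtain U where U: "\<And>i. open (U i)" "\<And>i. comeager {x. x \<in> a i \<longleftrightarrow> x \<in> U i}"
      by metis
    have "comeager (\<Inter>i. {x. x \<in> a i \<longleftrightarrow> x \<in> U i})"
      using U(2) by (rule comeager_INT)
    then have "comeager {x. x \<in> (\<Union>i. a i) \<longleftrightarrow> x \<in> (\<Union>i. U i)}"
      by (rule comeager_mono) auto
    then show ?case using U(1) by (intro exI[of _ "\<Union>i. U i"]) auto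
  qed
qed

text \<open>Each preimage of a basic open set agrees with an open set off a meager set. There are
  only countably many basic sets, so all these agreements hold at once on a comeager set, where the
  preimages are therefore relatively open.\<close>

lemma borel_measurable_continuous_on_comeager:
  fixes f :: "'a::topological_space \<Rightarrow> 'b::second_countable_topology"
  assumes "f \<in> measurable borel borel"
  obtains D where "comeager D" "continuous_on D f"
proof -
  obtain \<B> :: "'b set set" where \<B>: "countable \<B>" "topological_basis \<B>"
    using ex_countable_basis by blast
  have "\<exists>U. open U \<and> comeager {x. f x \<in> B \<longleftrightarrow> x \<in> U}" if "B \<in> \<B>" for B
  proof -
    have "f -` B \<inter> space borel \<in> sets borel"
      using that \<B>(2) assms by (intro measurable_sets[OF assms] borel_open topological_basis_open)
    then show ?thesis using borel_almost_open[of "f -` B"] by simp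
  qed
  then obtain U where U: "\<And>B. B \<in> \<B> \<Longrightarrow> open (U B)"
      "\<And>B. B \<in> \<B> \<Longrightarrow> comeager {x. f x \<in> B \<longleftrightarrow> x \<in> U B}"
    by metis
  define D where "D = (\<Inter>B\<in>\<B>. {x. f x \<in> B \<longleftrightarrow> x \<in> U B})"
  have "comeager D"
    unfolding D_def using \<B>(1) U(2) by (rule comeager_countable_INT)
  moreover have "continuous_on D f"
    unfolding continuous_on_topological
  proof (intro ballI allI impI)
    fix x V assume x: "x \<in> D" and V: "open V" "f x \<in> V"
    obtain B where B: "B \<in> \<B>" "f x \<in> B" "B \<subseteq> V"
      using topological_basisE[OF \<B>(2) V] by blast
    then have "x \<in> U B" "\<forall>y\<in>D. y \<in> U B \<longrightarrow> f y \<in> V"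
      using x by (auto simp: D_def)
    then show "\<exists>A. open A \<and> x \<in> A \<and> (\<forall>y\<in>D. y \<in> A \<longrightarrow> f y \<in> V)"
      using U(1) B(1) by blast
  qed
  ultimately show ?thesis using that by blast
qed

section \<open>Consequences of the Baire category theorem\<close>

lemma comeager_dense:
  fixes S :: "'a::topological_space set"
  assumes "completely_metrizable_space (euclidean :: 'a topology)"
    and "comeager S"
  shows "closure S = UNIV"
proof -
  obtain D where D: "\<And>n::nat. open (D n)" "\<And>n. closure (D n) = (UNIV :: 'a set)" "(\<Inter>n. D n) \<subseteq> S"
    using assms(2) unfolding comeager_def by blast
  have "euclidean closure_of \<Inter>(range D) = topspace (euclidean :: 'a topology)"
    by (rule Baire_category) (use assms(1) D in auto)
  then show ?thesis
    using D(3) closure_mono[of "\<Inter>(range D)" S] by auto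
qed

text \<open>A local form of the Baire category theorem. If it failed, every
  \<open>F n \<inter> closure W\<close> would have empty interior, although these sets cover the
  open set \<open>W\<close>.\<close>

lemma Baire_closed_cover:
  fixes F :: "nat \<Rightarrow> 'a::topological_space set"
  assumes "completely_metrizable_space (euclidean :: 'a topology)"
    and "\<And>n. closed (F n)" and "open W" "W \<noteq> {}" "W \<subseteq> (\<Union>n. F n)"
  obtains n V where "open V" "V \<noteq> {}" "V \<subseteq> W" "V \<subseteq> F n"
proof (rule ccontr)
  assume no: "\<not> thesis"
  have "W \<inter> interior (F n) = {}" for n
    using that[of "W \<inter> interior (F n)" n] no assms(3) interior_subset[of "F n"] by auto
  then have int: "interior (F n) \<subseteq> - W" for n by auto
  have "interior (F n \<inter> closure W) \<inter> W = {}" for n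
    using int[of n] interior_mono[of "F n \<inter> closure W" "F n"] by blast
  then have "interior (F n \<inter> closure W) \<inter> closure W = {}" for n
    using open_Int_closure_eq_empty[OF open_interior] by blast
  then have "interior (F n \<inter> closure W) = {}" for n
    using interior_subset[of "F n \<inter> closure W"] by blast
  then have "euclidean interior_of \<Union>(range (\<lambda>n. F n \<inter> closure W)) = {}"
    by (intro Baire_category_alt) (use assms in auto)
  then have "interior (\<Union>n. F n \<inter> closure W) = {}" by simp
  moreover have "W \<subseteq> interior (\<Union>n. F n \<inter> closure W)"
    by (rule interior_maximal) (use assms closure_subset in auto)
  ultimately show False using assms(4) by simp
qed

lemma completely_metrizable_Baire_space:
  "completely_metrizable_space (euclidean :: (nat \<Rightarrow> nat) topology)"
proof -
  have "(euclidean :: nat topology) = discrete_topology UNIV"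
    by (simp add: topology_eq open_discrete)
  then have "completely_metrizable_space (euclidean :: nat topology)"
    by (simp add: completely_metrizable_space_discrete_topology)
  then have "completely_metrizable_space (product_topology (\<lambda>i::nat. euclidean :: nat topology) UNIV)"
    by (simp add: completely_metrizable_space_product_topology)
  then show ?thesis by (simp add: euclidean_product_topology)
qed

section \<open>Cylinders and product sets in Baire space\<close>

lemma continuous_on_discrete_compose:
  fixes h :: "'a::topological_space \<Rightarrow> 'c::discrete_topology" and g :: "'c \<Rightarrow> 'd::topological_space"
  assumes "continuous_on S h"
  shows "continuous_on S (\<lambda>x. g (h x))"
proof -
  have "continuous_on UNIV g"
    by (simp add: continuous_on_open_vimage open_discrete)
  then show ?thesis by (rule continuous_on_compose2[OF _ assms]) simp
qed

lemma open_cylinder: "open {x :: nat \<Rightarrow> nat. \<forall>i<l. x i = s i}"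
proof -
  have "open {x :: nat \<Rightarrow> nat. \<forall>i\<in>{..<l}. x i \<in> {s i}}"
    by (rule product_topology_basis') (auto simp: open_discrete)
  then show ?thesis by (simp add: Ball_def)
qed

lemma open_contains_cylinder:
  fixes U :: "(nat \<Rightarrow> nat) set"
  assumes "open U" "s \<in> U"
  obtains l where "\<forall>x. (\<forall>i<l. x i = s i) \<longrightarrow> x \<in> U"
proof -
  have "openin (product_topology (\<lambda>i::nat. euclidean :: nat topology) UNIV) U"
    using assms(1) by (simp add: euclidean_product_topology)
  from product_topology_open_contains_basis[OF this assms(2)]
  obtain X where X: "s \<in> Pi\<^sub>E UNIV X" "finite {i. X i \<noteq> (UNIV::nat set)}" "Pi\<^sub>E UNIV X \<subseteq> U"
    by auto
  obtain l where l: "\<And>i. X i \<noteq> UNIV \<Longrightarrow> i < l"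
    using X(2)[unfolded finite_nat_set_iff_bounded] by blast
  have "x \<in> U" if "\<forall>i<l. x i = s i" for x
  proof -
    have "x i \<in> X i" for i
    proof (cases "X i = UNIV")
      case False
      then show ?thesis using X(1) l[of i] that by (auto simp: PiE_iff)
    qed simp
    then show ?thesis using X(3) by (auto simp: PiE_iff)
  qed
  then show ?thesis using that by blast
qed

text \<open>Only finitely many prefixes of length \<open>l\<close> are bounded by \<open>c\<close>.
  They are treated one after another, each time prolonging the block \<open>t\<close> so that it
  forces membership in \<open>W\<close> after the new prefix too; longer blocks keep what shorter
  ones forced.\<close>

lemma dense_open_extend_bounded:
  fixes W :: "(nat \<Rightarrow> nat) set"
  assumes W: "open W" "closure W = UNIV"
  shows "\<exists>t l'. l \<le> l' \<and> (\<forall>x. (\<forall>i<l. x i \<le> c i) \<longrightarrow> (\<forall>i. l \<le> i \<and> i < l' \<longrightarrow> x i = t i) \<longrightarrow> x \<in> W)"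
proof -
  have ext: "\<exists>t l'. l \<le> l' \<and> (\<forall>i<l. t i = s i) \<and> (\<forall>x. (\<forall>i<l'. x i = t i) \<longrightarrow> x \<in> W)" for s l
  proof -
    have "{x. \<forall>i<l. x i = s i} \<inter> W \<noteq> {}"
      using open_Int_closure_eq_empty[OF open_cylinder, of l s W] W(2) by auto
    then obtain t where t: "\<forall>i<l. t i = s i" "t \<in> W" by blast
    obtain l1 where "\<forall>x. (\<forall>i<l1. x i = t i) \<longrightarrow> x \<in> W"
      by (rule open_contains_cylinder[OF W(1) t(2)])
    then show ?thesis
      using t(1) by (intro exI[of _ t] exI[of _ "max l l1"]) simp
  qed
  have *: "\<exists>t l'. l \<le> l' \<and> (\<forall>s\<in>P. \<forall>x. (\<forall>i<l. x i = s i) \<and> (\<forall>i. l \<le> i \<and> i < l' \<longrightarrow> x i = t i) \<longrightarrow> x \<in> W)"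
    if "finite P" for P
    using that
  proof (induction P rule: finite_induct)
    case empty
    show ?case by auto
  next
    case (insert s P)
    then obtain t l' where t: "l \<le> l'"
      "\<And>r x. r \<in> P \<Longrightarrow> \<forall>i<l. x i = r i \<Longrightarrow> \<forall>i. l \<le> i \<and> i < l' \<longrightarrow> x i = t i \<Longrightarrow> x \<in> W"
      by blast
    obtain t' l'' where t': "l' \<le> l''" "\<forall>i<l'. t' i = (if i < l then s i else t i)"
      "\<And>x. \<forall>i<l''. x i = t' i \<Longrightarrow> x \<in> W"
      using ext[of l' "\<lambda>i. if i < l then s i else t i"] by blast
    have "x \<in> W" if r: "r \<in> insert s P" and x: "\<forall>i<l. x i = r i" "\<forall>i. l \<le> i \<and> i < l'' \<longrightarrow> x i = t' i" for r x
    proof (cases "r = s")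
      case True
      have "x i = t' i" if "i < l''" for i
        using x t'(2) True that t(1) by (cases "i < l") auto
      then show ?thesis using t'(3) by blast
    next
      case False
      then show ?thesis using t(2)[of r x] r x t' by auto
    qed
    then have "l \<le> l'' \<and> (\<forall>r\<in>insert s P. \<forall>x. (\<forall>i<l. x i = r i) \<and>
        (\<forall>i. l \<le> i \<and> i < l'' \<longrightarrow> x i = t' i) \<longrightarrow> x \<in> W)"
      using t(1) t'(1) by simp
    then show ?case by blast
  qed
  define P where "P = (\<Pi>\<^sub>E i\<in>{..<l}. {..c i})"
  have fin: "finite P"
    unfolding P_def by (intro finite_PiE) auto
  obtain t l' where "l \<le> l' \<and> (\<forall>s\<in>P. \<forall>x. (\<forall>i<l. x i = s i) \<and>
      (\<forall>i. l \<le> i \<and> i < l' \<longrightarrow> x i = t i) \<longrightarrow> x \<in> W)"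
    using *[OF fin] by (elim exE)
  then have t: "l \<le> l'" and tP: "\<forall>s\<in>P. \<forall>x. (\<forall>i<l. x i = s i) \<and>
      (\<forall>i. l \<le> i \<and> i < l' \<longrightarrow> x i = t i) \<longrightarrow> x \<in> W"
    by auto
  have "x \<in> W" if "\<forall>i<l. x i \<le> c i" "\<forall>i. l \<le> i \<and> i < l' \<longrightarrow> x i = t i" for x
  proof -
    have "restrict x {..<l} \<in> P" using that(1) by (auto simp: P_def)
    then show ?thesis using tP that(2) by simp
  qed
  then show ?thesis using t by (intro exI[of _ t] exI[of _ l']) simp
qed

text \<open>A fusion argument. Free coordinates and blocks of frozen values alternate: after the
  free coordinate \<open>a n\<close>, a block forces membership in \<open>W n\<close> whatever
  bounded values the free coordinates so far take.\<close>

lemma comeager_contains_product: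
  fixes D :: "(nat \<Rightarrow> nat) set" and K :: "nat \<Rightarrow> nat set" and b :: "nat \<Rightarrow> nat"
  assumes "comeager D" and K: "\<And>i. infinite (K i)"
  shows "\<exists>A z. (\<forall>i. infinite (A \<inter> K i)) \<and>
    (\<forall>x. (\<forall>k. x k \<le> b k) \<longrightarrow> (\<lambda>k. if k \<in> A then x k else z k) \<in> D)"
proof -
  obtain W where W: "\<And>n::nat. open (W n)" "\<And>n. closure (W n) = (UNIV :: (nat \<Rightarrow> nat) set)"
      "(\<Inter>n. W n) \<subseteq> D"
    using assms(1) unfolding comeager_def by blast
  define Q :: "nat \<Rightarrow> (nat \<Rightarrow> nat) \<times> nat \<times> nat \<Rightarrow> (nat \<Rightarrow> nat) \<times> nat \<times> nat \<Rightarrow> bool"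
    where "Q n = (\<lambda>(z, l, a) (z', l', a'). l \<le> a' \<and> a' \<in> K (fst (prod_decode n)) \<and> a' < l' \<and>
      (\<forall>i\<le>a'. z' i = z i) \<and>
      (\<forall>x. (\<forall>i\<le>a'. x i \<le> max (b i) (z' i)) \<and> (\<forall>i. a' < i \<and> i < l' \<longrightarrow> x i = z' i) \<longrightarrow> x \<in> W n))"
    for n
  have step: "\<exists>\<tau>. True \<and> Q n \<sigma> \<tau>" for n \<sigma>
  proof -
    obtain z l a where \<sigma>: "\<sigma> = (z, l, a)" by (cases \<sigma>)
    obtain a' where a': "l \<le> a'" "a' \<in> K (fst (prod_decode n))"
      using K[of "fst (prod_decode n)"] unfolding infinite_nat_iff_unbounded_le by blast
    obtain t l' where "Suc a' \<le> l' \<and> (\<forall>x. (\<forall>i<Suc a'. x i \<le> max (b i) (z i)) \<longrightarrow>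
         (\<forall>i. Suc a' \<le> i \<and> i < l' \<longrightarrow> x i = t i) \<longrightarrow> x \<in> W n)"
      using dense_open_extend_bounded[OF W(1,2), of "Suc a'" "\<lambda>i. max (b i) (z i)" n] by (elim exE)
    then have "Q n \<sigma> (\<lambda>i. if i \<le> a' then z i else t i, l', a')"
      using a' by (simp add: Q_def \<sigma> less_Suc_eq_le Suc_le_eq)
    then show ?thesis by blast
  qed
  have "\<exists>\<sigma>. \<forall>n. True \<and> Q n (\<sigma> n) (\<sigma> (Suc n))"
    by (rule dependent_nat_choice) (use step in auto)
  then obtain \<sigma> where \<sigma>: "\<And>n. Q n (\<sigma> n) (\<sigma> (Suc n))" by blast
  define z l a where "z n = fst (\<sigma> n)" and "l n = fst (snd (\<sigma> n))" and "a n = snd (snd (\<sigma> (Suc n)))" for n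
  have la: "l n \<le> a n" and aK: "a n \<in> K (fst (prod_decode n))" and al: "a n < l (Suc n)"
    and zz: "\<And>i. i \<le> a n \<Longrightarrow> z (Suc n) i = z n i"
    and hit: "\<And>x. (\<And>i. i \<le> a n \<Longrightarrow> x i \<le> max (b i) (z (Suc n) i)) \<Longrightarrow>
         (\<And>i. a n < i \<Longrightarrow> i < l (Suc n) \<Longrightarrow> x i = z (Suc n) i) \<Longrightarrow> x \<in> W n" for n
    using \<sigma>[of n] by (simp_all add: Q_def z_def l_def a_def case_prod_beta)
  have smono: "strict_mono a"
    unfolding strict_mono_Suc_iff using la al by (meson less_le_trans)
  have lmono: "l m \<le> l n" if "m \<le> n" for m n
    using that by (rule lift_Suc_mono_le[rotated]) (use la al in \<open>meson le_trans less_imp_le\<close>)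
  have ln: "n \<le> l n" for n
  proof (induction n)
    case (Suc n)
    then show ?case using la[of n] al[of n] by linarith
  qed simp
  have zstab: "z n i = z m i" if "m \<le> n" "i < l m" for m n i
    using that(1)
  proof (induction n rule: dec_induct)
    case (step n)
    have "i \<le> a n" using that(2) lmono[OF step(1)] la[of n] by linarith
    then show ?case using zz step by simp
  qed simp
  \<comment> \<open>Position \<open>i\<close> no longer changes once \<open>i < l n\<close>, and
    \<open>n \<le> l n\<close>, so stage \<open>Suc i\<close> already shows its final value.\<close>
  define z' where "z' i = z (Suc i) i" for i
  have z': "z' i = z n i" if "i < l n" for n i
  proof -
    have "i < l (Suc i)" using ln[of "Suc i"] by linarith
    then show ?thesis using zstab[of n "Suc i" i] zstab[of "Suc i" n i] that
      unfolding z'_def by (cases "n \<le> Suc i") auto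
  qed
  \<comment> \<open>The first component of \<open>prod_decode n\<close> takes every value
    \<open>i\<close> infinitely often, so each \<open>K i\<close> is served infinitely
    often.\<close>
  have "infinite (range a \<inter> K i)" for i
  proof -
    have "a ` (\<lambda>j. prod_encode (i, j)) ` UNIV \<subseteq> range a \<inter> K i"
      using aK by (auto, metis fst_conv prod_encode_inverse)
    moreover have "infinite (a ` (\<lambda>j. prod_encode (i, j)) ` UNIV)"
      using strict_mono_imp_inj_on[OF smono]
      by (auto simp: finite_image_iff inj_on_def intro!: inj_onI)
    ultimately show ?thesis using finite_subset by blast
  qed
  moreover have "(\<lambda>k. if k \<in> range a then x k else z' k) \<in> D" if x: "\<forall>k. x k \<le> b k" for x
  proof -
    have "(\<lambda>k. if k \<in> range a then x k else z' k) \<in> W n" for n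
    proof (rule hit)
      show "(if i \<in> range a then x i else z' i) \<le> max (b i) (z (Suc n) i)" if "i \<le> a n" for i
        using x[rule_format, of i] z'[of i "Suc n"] al[of n] that by auto
      show "(if i \<in> range a then x i else z' i) = z (Suc n) i" if i: "a n < i" "i < l (Suc n)" for i
      proof -
        have "i \<notin> range a"
        proof
          assume "i \<in> range a"
          then obtain m where m: "i = a m" by blast
          then have "n < m" using i(1) smono by (simp add: strict_mono_less)
          then show False using lmono[of "Suc n" m] la[of m] i(2) m by simp
        qed
        then show ?thesis using z' i by simp
      qed
    qed
    then show ?thesis using W(3) by blast
  qed
  ultimately show ?thesis by (intro exI[of _ "range a"] exI[of _ z']) simp
qed

text \<open>Truncation by \<open>b\<close> maps all of Baire space onto a product set inside a
  comeager set on which \<open>f\<close> is continuous. The composition is then continuous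
  everywhere, and infinitely many coordinates in each \<open>K i\<close> stay free.\<close>

lemma borel_measurable_continuous_on_product:
  fixes f :: "(nat \<Rightarrow> nat) \<Rightarrow> 'b::second_countable_topology" and K :: "nat \<Rightarrow> nat set"
  assumes "f \<in> measurable borel borel" and "\<And>i. infinite (K i)"
  shows "\<exists>A z. (\<forall>i. infinite (A \<inter> K i)) \<and>
    continuous_on UNIV (\<lambda>x. f (\<lambda>k. if k \<in> A then min (x k) (b k) else z k))"
proof -
  obtain D where D: "comeager D" "continuous_on D f"
    by (rule borel_measurable_continuous_on_comeager[OF assms(1)])
  obtain A z where Az: "(\<forall>i. infinite (A \<inter> K i)) \<and>
      (\<forall>x. (\<forall>k. x k \<le> b k) \<longrightarrow> (\<lambda>k. if k \<in> A then x k else z k) \<in> D)"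
    using comeager_contains_product[where K = K and b = b, OF D(1) assms(2)] by (elim exE)
  have "continuous_on UNIV (\<lambda>x::nat \<Rightarrow> nat. (\<lambda>k. if k \<in> A then min (x k) (b k) else z k))"
    by (intro continuous_on_coordinatewise_then_product
        continuous_on_discrete_compose[where g = "\<lambda>v. if i \<in> A then min v (b i) else z i" for i]
        continuous_on_product_coordinates)
  then have "continuous_on UNIV (\<lambda>x. f (\<lambda>k. if k \<in> A then min (x k) (b k) else z k))"
    by (rule continuous_on_compose2[OF D(2)]) (use Az in auto)
  with Az show ?thesis by (intro exI[of _ A] exI[of _ z]) simp
qed

section \<open>Non-reducibility\<close>

text \<open>On a product set with infinitely many free coordinates in each column, the class of
  \<open>0\<close> pulls back to the union of the closed sets \<open>G m\<close>. By Baire one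
  \<open>G m\<close> contains every \<open>X \<delta>\<close> with \<open>\<delta>\<close> in some
  cylinder; being closed, it also contains a point with a full column, which is inequivalent to
  \<open>0\<close>.\<close>

lemma omega_power_E0_not_reducible_E0: "\<not> omega_power E0 \<le>\<^sub>B E0"
proof
  assume "omega_power E0 \<le>\<^sub>B E0"
  then obtain f :: "(nat \<Rightarrow> nat \<Rightarrow> bool) \<Rightarrow> (nat \<Rightarrow> bool)"
    where f: "f \<in> measurable borel borel" "\<And>x y. omega_power E0 x y \<longleftrightarrow> E0 (f x) (f y)"
    unfolding borel_reducible_def by blast
  \<comment> \<open>The reduction is moved to Baire space: \<open>\<phi>\<close> reads nonzero
    entries as true bits and \<open>\<psi>\<close> embeds bits in the naturals. Since
    \<open>\<psi>\<close> is injective in every coordinate, eventual agreement is unchanged.\<close>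
  define \<phi> :: "(nat \<Rightarrow> nat) \<Rightarrow> nat \<Rightarrow> nat \<Rightarrow> bool"
    where "\<phi> x i n \<longleftrightarrow> x (prod_encode (i, n)) \<noteq> 0" for x i n
  define \<psi> :: "(nat \<Rightarrow> bool) \<Rightarrow> nat \<Rightarrow> nat" where "\<psi> v n = of_bool (v n)" for v n
  have "continuous_on UNIV \<phi>"
    unfolding \<phi>_def by (intro continuous_on_coordinatewise_then_product
      continuous_on_discrete_compose[where g = "\<lambda>v. v \<noteq> 0"] continuous_on_product_coordinates)
  moreover have "continuous_on UNIV \<psi>"
    unfolding \<psi>_def by (intro continuous_on_coordinatewise_then_product
      continuous_on_discrete_compose[where g = of_bool] continuous_on_product_coordinates)
  ultimately have meas: "(\<lambda>x. \<psi> (f (\<phi> x))) \<in> measurable borel borel"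
    by (intro measurable_compose[OF measurable_compose[OF _ f(1)]] borel_measurable_continuous_onI)
  have K: "infinite (range (\<lambda>n. prod_encode (i, n)))" for i
    by (intro range_inj_infinite) (auto simp: inj_def)
  obtain A z where A: "(\<forall>i. infinite (A \<inter> range (\<lambda>n. prod_encode (i, n)))) \<and>
      continuous_on UNIV (\<lambda>x. \<psi> (f (\<phi> (\<lambda>k. if k \<in> A then min (x k) 1 else z k))))"
    using borel_measurable_continuous_on_product[where K = "\<lambda>i. range (\<lambda>n. prod_encode (i, n))"
        and b = "\<lambda>_. 1", OF meas K] by (elim exE)
  define h where "h x = (\<lambda>k. if k \<in> A then min (x k) 1 else z k)" for x :: "nat \<Rightarrow> nat"
  define g where "g x = \<psi> (f (\<phi> (h x)))" for x
  have cg: "continuous_on UNIV g"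
    using A unfolding g_def h_def by blast
  have cgn: "continuous_on UNIV (\<lambda>x. g x n)" for n
    using cg by (rule continuous_on_product_then_coordinatewise)
  have equiv: "(\<exists>m. \<forall>n>m. g x n = g y n) \<longleftrightarrow> (\<forall>i. \<exists>m. \<forall>n>m. \<phi> (h x) i n = \<phi> (h y) i n)" for x y
  proof -
    have "\<psi> v n = \<psi> w n \<longleftrightarrow> v n = w n" for v w n by (simp add: \<psi>_def)
    then show ?thesis
      using f(2)[of "\<phi> (h x)" "\<phi> (h y)"] by (simp only: g_def E0_def omega_power_def)
  qed
  define G where "G m = {x. \<forall>n>m. g x n = g (\<lambda>_. 0) n}" for m
  have closedG: "closed (G m)" for m
    unfolding G_def by (intro closed_Collect_all closed_Collect_imp closed_Collect_eq cgn) auto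
  \<comment> \<open>\<open>\<delta> i\<close> codes the finite support of column \<open>i\<close>, so \<open>X\<close> maps continuously into the class of \<open>0\<close>.\<close>
  define X where "X \<delta> k = (of_bool (snd (prod_decode k) \<in> set_decode (\<delta> (fst (prod_decode k)))) :: nat)"
    for \<delta> :: "nat \<Rightarrow> nat" and k
  have cX: "continuous_on UNIV X"
    unfolding X_def by (intro continuous_on_coordinatewise_then_product
      continuous_on_discrete_compose[where g = "\<lambda>v. of_bool (snd (prod_decode k) \<in> set_decode v)" for k]
      continuous_on_product_coordinates)
  have closedF: "closed (X -` G m)" for m
    using closed_vimage[OF closedG[of m] cX] by simp
  have "\<exists>m. X \<delta> \<in> G m" for \<delta>
  proof -
    have "\<exists>m. \<forall>n>m. \<phi> (h (X \<delta>)) i n = \<phi> (h (\<lambda>_. 0)) i n" for i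
    proof -
      have "finite (set_decode (\<delta> i))" by simp
      then obtain m where "\<forall>n\<in>set_decode (\<delta> i). n \<le> m"
        using finite_nat_set_iff_bounded_le by blast
      then show ?thesis by (intro exI[of _ m]) (auto simp: \<phi>_def h_def X_def)
    qed
    then show ?thesis using equiv[of "X \<delta>" "\<lambda>_. 0"] by (simp add: G_def)
  qed
  then have cover: "UNIV \<subseteq> (\<Union>m. X -` G m)" by auto
  obtain m V where V: "open V" "V \<noteq> {}" "V \<subseteq> UNIV" "V \<subseteq> X -` G m"
    by (rule Baire_closed_cover[OF completely_metrizable_Baire_space closedF open_UNIV UNIV_not_empty cover])
  then obtain s where s: "s \<in> V" by blast
  obtain l where l: "\<forall>x. (\<forall>i<l. x i = s i) \<longrightarrow> x \<in> V"
    by (rule open_contains_cylinder[OF V(1) s])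
  \<comment> \<open>The columns below \<open>l\<close> are those of \<open>X s\<close> and all
    others are full, so \<open>y\<close> differs from \<open>0\<close> at every free coordinate of
    column \<open>l\<close>.\<close>
  define y where "y k = (if fst (prod_decode k) < l then X s k else 1)" for k
  have "y \<in> G m"
  proof (rule ccontr)
    assume "y \<notin> G m"
    then have "y \<in> - G m" by simp
    then obtain L where L: "\<forall>x. (\<forall>i<L. x i = y i) \<longrightarrow> x \<in> - G m"
      by (rule open_contains_cylinder[OF open_Compl[OF closedG]])
    \<comment> \<open>Filling the later columns with \<open>{..<L}\<close> matches \<open>y\<close>
      below \<open>L\<close>, since a code is at least as large as its second component.\<close>
    define \<delta> where "\<delta> i = (if i < l then s i else set_encode {..<L})" for i
    have "\<delta> \<in> V" by (rule l[rule_format]) (auto simp: \<delta>_def)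
    then have "X \<delta> \<in> G m" using V(4) by blast
    moreover have "X \<delta> k = y k" if "k < L" for k
    proof -
      have "snd (prod_decode k) \<le> k"
        by (metis le_prod_encode_2 prod.collapse prod_decode_inverse)
      then show ?thesis using that by (auto simp: X_def y_def \<delta>_def set_encode_inverse)
    qed
    ultimately show False using L by blast
  qed
  then have "\<exists>m. \<forall>n>m. g y n = g (\<lambda>_. 0) n"
    by (auto simp: G_def)
  then obtain M where M: "\<And>n. n > M \<Longrightarrow> \<phi> (h y) l n = \<phi> (h (\<lambda>_. 0)) l n"
    unfolding equiv by blast
  have "A \<inter> range (\<lambda>n. prod_encode (l, n)) \<subseteq> (\<lambda>n. prod_encode (l, n)) ` {..M}"
  proof
    fix k assume "k \<in> A \<inter> range (\<lambda>n. prod_encode (l, n))"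
    then obtain n where n: "k = prod_encode (l, n)" "k \<in> A" by blast
    then have "\<not> n > M" using M[of n] by (auto simp: \<phi>_def h_def y_def)
    then show "k \<in> (\<lambda>n. prod_encode (l, n)) ` {..M}" using n by auto
  qed
  then have "finite (A \<inter> range (\<lambda>n. prod_encode (l, n)))"
    by (rule finite_subset) simp
  then show False using A by blast
qed

section \<open>Generic ergodicity with respect to \<open>=\<^sup>+\<close>\<close>

lemma eq_plus_iff_range_eq: "eq_plus x y \<longleftrightarrow> range x = range y"
proof -
  have "(\<forall>n. \<exists>m. x n = y m) \<longleftrightarrow> range x \<subseteq> range y" by auto
  moreover have "(\<forall>m. \<exists>n. x n = y m) \<longleftrightarrow> (\<forall>m. \<exists>n. y m = x n)" by (simp only: eq_commute)
  moreover have "(\<forall>m. \<exists>n. y m = x n) \<longleftrightarrow> range y \<subseteq> range x" by auto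
  ultimately show ?thesis unfolding eq_plus_def plus_jump_def by auto
qed

text \<open>A continuous version of Hjorth's argument that turbulent orbit equivalence relations are
  generically ergodic with respect to \<open>=\<^sup>+\<close>: two applications of the Baire category theorem make the
  index \<open>n\<close> with \<open>g (x + e) n = g x m\<close> independent of \<open>x\<close> and \<open>e\<close>, and then the value cannot
  change along a chain of steps \<open>x \<mapsto> x + e\<close>.\<close>

lemma generically_locally_constant:
  fixes g :: "(nat \<Rightarrow> nat) \<Rightarrow> nat \<Rightarrow> nat \<Rightarrow> nat"
  assumes cont: "continuous_on UNIV g"
    and inv: "\<And>x y N. \<forall>k\<ge>N. y k = x k \<or> y k = Suc (x k) \<Longrightarrow> range (g x) = range (g y)"
  shows "\<exists>t l'. l \<le> l' \<and> (\<forall>i<l. t i = s i) \<and> (\<forall>x. (\<forall>i<l'. x i = t i) \<longrightarrow> g x m = g t m)"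
proof -
  have cgn: "continuous_on UNIV (\<lambda>x. g x n j)" for n j
    by (rule continuous_on_product_then_coordinatewise[OF continuous_on_product_then_coordinatewise[OF cont]])
  \<comment> \<open>The truncation \<open>min (e k) 1\<close> lets \<open>e\<close> range over all
    of Baire space while only \<open>0\<close>-\<open>1\<close> sequences are added.\<close>
  define R where "R x e = (\<lambda>k. x k + min (e k) 1)" for x e :: "nat \<Rightarrow> nat"
  have cR1: "continuous_on UNIV (\<lambda>x. R x e)" for e
    unfolding R_def by (intro continuous_on_coordinatewise_then_product
      continuous_on_discrete_compose[where g = "\<lambda>v. v + min (e k) 1" for k] continuous_on_product_coordinates)
  have cR2: "continuous_on UNIV (R x)" for x
    unfolding R_def by (intro continuous_on_coordinatewise_then_product
      continuous_on_discrete_compose[where g = "\<lambda>v. x k + min v 1" for k] continuous_on_product_coordinates)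
  have closed_eq: "closed {w. u w = v w}"
    if "\<And>j. continuous_on UNIV (\<lambda>w. u w j)" "\<And>j. continuous_on UNIV (\<lambda>w. v w j)"
    for u v :: "(nat \<Rightarrow> nat) \<Rightarrow> nat \<Rightarrow> nat"
    unfolding fun_eq_iff by (intro closed_Collect_all closed_Collect_eq that)
  \<comment> \<open>\<open>C (n, us)\<close> holds the \<open>x\<close> for which one index
    \<open>n\<close> works for all \<open>e\<close> extending \<open>us\<close>. Baire in the
    variable \<open>e\<close> puts every \<open>x\<close> into some \<open>C p\<close>; Baire in
    \<open>x\<close> then makes one \<open>p\<close> work on a whole cylinder.\<close>
  define C :: "nat \<times> nat list \<Rightarrow> (nat \<Rightarrow> nat) set" where "C = (\<lambda>(n, us). {x. \<forall>e. (\<forall>i<length us. e i = us ! i) \<longrightarrow> g (R x e) n = g x m})"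
  have closedC: "closed (C p)" for p
    unfolding C_def case_prod_beta
    by (intro closed_Collect_all closed_Collect_imp closed_eq cgn continuous_on_compose2[OF cgn cR1]) auto
  have "\<exists>p. x \<in> C p" for x
  proof -
    have closedF: "closed {e. g (R x e) n = g x m}" for n
      by (intro closed_eq continuous_on_compose2[OF cgn cR2]) auto
    have "\<exists>n. g (R x e) n = g x m" for e
    proof -
      have "range (g x) = range (g (R x e))"
        by (rule inv[of 0]) (auto simp: R_def min_def)
      then show ?thesis by (metis rangeE rangeI)
    qed
    then have cover: "UNIV \<subseteq> (\<Union>n. {e. g (R x e) n = g x m})" by auto
    obtain n V where V: "open V" "V \<noteq> {}" "V \<subseteq> UNIV" "V \<subseteq> {e. g (R x e) n = g x m}"
      by (rule Baire_closed_cover[OF completely_metrizable_Baire_space closedF open_UNIV UNIV_not_empty cover])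
    then obtain u where u: "u \<in> V" by blast
    obtain L where L: "\<forall>x. (\<forall>i<L. x i = u i) \<longrightarrow> x \<in> V"
      by (rule open_contains_cylinder[OF V(1) u])
    have "x \<in> C (n, map u [0..<L])"
      using V(4) L by (auto simp: C_def)
    then show ?thesis by blast
  qed
  then have cover: "{x. \<forall>i<l. x i = s i} \<subseteq> (\<Union>k. C (from_nat k))"
    by (auto, metis from_nat_to_nat)
  have ne: "{x. \<forall>i<l. x i = s i} \<noteq> {}" by auto
  obtain k V where V: "open V" "V \<noteq> {}" "V \<subseteq> {x. \<forall>i<l. x i = s i}" "V \<subseteq> C (from_nat k)"
    by (rule Baire_closed_cover[OF completely_metrizable_Baire_space closedC open_cylinder ne cover])
  obtain n :: nat and us :: "nat list" where k: "from_nat k = (n, us)" by fastforce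
  obtain t where t: "t \<in> V" using V(2) by blast
  obtain l0 where l0: "\<forall>x. (\<forall>i<l0. x i = t i) \<longrightarrow> x \<in> V"
    by (rule open_contains_cylinder[OF V(1) t])
  define l' where "l' = max l (max l0 (length us))"
  have C: "g (R x e) n = g x m" if "\<forall>i<l'. x i = t i" "\<forall>i<length us. e i = us ! i" for x e
  proof -
    have "x \<in> V" by (rule l0[rule_format]) (use that(1) in \<open>auto simp: l'_def\<close>)
    then have "x \<in> C (n, us)" using V(4) k by auto
    then show ?thesis using that(2) by (simp add: C_def)
  qed
  have step: "g x m = g x' m"
    if x: "\<forall>i<l'. x i = t i" and x': "\<forall>i<l'. x' i = t i" and xx': "\<forall>k. x k \<le> x' k \<and> x' k \<le> Suc (x k)" for x x'
  proof -
    \<comment> \<open>Both \<open>e\<close> and \<open>e'\<close> extend \<open>us\<close>, so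
      \<open>C\<close> applies to each. On that prefix \<open>x\<close> and \<open>x'\<close> equal
      \<open>t\<close>; beyond it \<open>e\<close> makes up the difference between them.\<close>
    define e where "e k = (if k < length us then us ! k else x' k - x k)" for k
    define e' where "e' k = (if k < length us then us ! k else 0)" for k
    have "R x e = R x' e'"
    proof
      fix k
      show "R x e k = R x' e' k"
      proof (cases "k < length us")
        case True
        then have "k < l'" by (simp add: l'_def)
        then show ?thesis using x x' True by (simp add: R_def e_def e'_def)
      next
        case False
        then show ?thesis using xx'[rule_format, of k] by (auto simp: R_def e_def e'_def)
      qed
    qed
    then show ?thesis using C[OF x, of e] C[OF x', of e'] by (simp add: e_def e'_def)
  qed
  have steps: "g x m = g x' m"
    if "\<forall>i<l'. x i = t i" "\<forall>i<l'. x' i = t i" "\<forall>k. x k \<le> x' k \<and> x' k \<le> x k + c" for x x' c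
    using that
  proof (induction c arbitrary: x)
    case 0
    then have "x = x'" by (auto intro!: ext simp: le_antisym)
    then show ?case by simp
  next
    case (Suc c)
    define x1 where "x1 k = min (x' k) (Suc (x k))" for k
    have "g x m = g x1 m"
      by (rule step) (use Suc.prems in \<open>auto simp: x1_def\<close>)
    also have "g x1 m = g x' m"
      by (rule Suc.IH) (use Suc.prems in \<open>auto simp: x1_def min_def\<close>)
    finally show ?case .
  qed
  \<comment> \<open>Two sequences that differ at finitely many places lie a bounded number of unit
    steps below their pointwise maximum.\<close>
  have fin: "g x m = g x' m"
    if "\<forall>i<l'. x i = t i" "\<forall>i<l'. x' i = t i" "\<forall>k\<ge>L. x k = x' k" for x x' L
  proof -
    define y where "y k = max (x k) (x' k)" for k
    define c where "c = (\<Sum>k<L. x k + x' k)"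
    have c: "x k + x' k \<le> c" if "k < L" for k
      unfolding c_def using that by (intro member_le_sum) auto
    have "x k \<le> y k \<and> y k \<le> x k + c" "x' k \<le> y k \<and> y k \<le> x' k + c" for k
      using c[of k] that(3) by (cases "k < L"; auto simp: y_def)+
    then have "g x m = g y m" "g x' m = g y m"
      using that by (auto intro!: steps[where c = c] simp: y_def)
    then show ?thesis by simp
  qed
  \<comment> \<open>Each coordinate of \<open>g x m\<close> depends only on a finite prefix of
    \<open>x\<close>, so the tail of \<open>x\<close> may be replaced by that of
    \<open>t\<close>.\<close>
  have const: "g x m = g t m" if x: "\<forall>i<l'. x i = t i" for x
  proof
    fix j
    have op: "open {y. g y m j = g x m j}"
      using open_vimage[OF open_discrete[of "{g x m j}"] cgn[of m j]] by (simp add: vimage_def)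
    have mem: "x \<in> {y. g y m j = g x m j}" by simp
    obtain L where L: "\<forall>y. (\<forall>i<L. y i = x i) \<longrightarrow> y \<in> {y. g y m j = g x m j}"
      by (rule open_contains_cylinder[OF op mem])
    define y where "y k = (if k < max L l' then x k else t k)" for k
    have "g y m j = g x m j"
      using L[THEN spec, of y] by (simp add: y_def less_max_iff_disj)
    moreover have "g y m = g t m"
      by (rule fin[of _ _ "max L l'"]) (use x in \<open>auto simp: y_def\<close>)
    ultimately show "g x m j = g t m j" by simp
  qed
  have "\<forall>i<l. t i = s i" using subsetD[OF V(3) t] by simp
  moreover have "l \<le> l'" by (simp add: l'_def)
  ultimately have "l \<le> l' \<and> (\<forall>i<l. t i = s i) \<and> (\<forall>x. (\<forall>i<l'. x i = t i) \<longrightarrow> g x m = g t m)"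
    using const by blast
  then show ?thesis by (intro exI)
qed

lemma closure_eq_UNIV_cylinder:
  fixes W :: "(nat \<Rightarrow> nat) set"
  assumes "\<And>s l. \<exists>x\<in>W. \<forall>i<l. x i = s i"
  shows "closure W = UNIV"
proof -
  have "x \<in> closure W" for x
  proof (rule ccontr)
    assume "x \<notin> closure W"
    then have "x \<in> - closure W" by simp
    then obtain l where l: "\<forall>y. (\<forall>i<l. y i = x i) \<longrightarrow> y \<in> - closure W"
      by (rule open_contains_cylinder[OF open_Compl[OF closed_closure]])
    obtain y where "y \<in> W" "\<forall>i<l. y i = x i" using assms by blast
    then show False using l closure_subset by blast
  qed
  then show ?thesis by blast
qed

text \<open>On a comeager set every \<open>g x m\<close> is determined by a prefix of
  \<open>x\<close>, so only countably many values occur. Whether a value \<open>a\<close> occurs is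
  invariant under finite changes of \<open>x\<close>, so a topological 0-1 law decides it
  generically.\<close>

lemma generically_constant_range:
  fixes g :: "(nat \<Rightarrow> nat) \<Rightarrow> nat \<Rightarrow> nat \<Rightarrow> nat"
  assumes cont: "continuous_on UNIV g"
    and inv: "\<And>x y N. \<forall>k\<ge>N. y k = x k \<or> y k = Suc (x k) \<Longrightarrow> range (g x) = range (g y)"
  shows "\<exists>D. comeager D \<and> (\<forall>x\<in>D. \<forall>y\<in>D. range (g x) = range (g y))"
proof -
  have cgn: "continuous_on UNIV (\<lambda>x. g x n j)" for n j
    by (rule continuous_on_product_then_coordinatewise[OF continuous_on_product_then_coordinatewise[OF cont]])
  define P where "P m = {x. \<exists>l. \<forall>y. (\<forall>i<l. y i = x i) \<longrightarrow> g y m = g x m}" for m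
  have comP: "comeager (P m)" for m
  proof (rule comeager_open_dense)
    show "open (P m)"
    proof (subst open_subopen, intro ballI)
      fix x assume "x \<in> P m"
      then obtain l where l: "\<forall>y. (\<forall>i<l. y i = x i) \<longrightarrow> g y m = g x m"
        unfolding P_def mem_Collect_eq by (elim exE)
      have "{y. \<forall>i<l. y i = x i} \<subseteq> P m"
      proof
        fix y assume "y \<in> {y. \<forall>i<l. y i = x i}"
        then have y: "\<forall>i<l. y i = x i" by simp
        have "g w m = g y m" if "\<forall>i<l. w i = y i" for w
        proof -
          have "\<forall>i<l. w i = x i" using that y by simp
          then show ?thesis using l y by metis
        qed
        then show "y \<in> P m" unfolding P_def by blast
      qed
      then show "\<exists>T. open T \<and> x \<in> T \<and> T \<subseteq> P m"
        by (intro exI[of _ "{y. \<forall>i<l. y i = x i}"]) (simp add: open_cylinder)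
    qed
    show "closure (P m) = UNIV"
    proof (rule closure_eq_UNIV_cylinder)
      fix s l
      have "\<exists>t l'. l \<le> l' \<and> (\<forall>i<l. t i = s i) \<and> (\<forall>x. (\<forall>i<l'. x i = t i) \<longrightarrow> g x m = g t m)"
        using cont inv by (rule generically_locally_constant)
      then obtain t l' where t: "l \<le> l' \<and> (\<forall>i<l. t i = s i) \<and> (\<forall>x. (\<forall>i<l'. x i = t i) \<longrightarrow> g x m = g t m)"
        by (elim exE)
      then have "t \<in> P m" unfolding P_def mem_Collect_eq by (intro exI[of _ l']) (elim conjE)
      then show "\<exists>x\<in>P m. \<forall>i<l. x i = s i"
        using t by (intro bexI[of _ t]) simp_all
    qed
  qed
  \<comment> \<open>A value determined by a prefix is found again at that prefix continued by
    zeros.\<close>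
  define Vals where "Vals = range (\<lambda>(m, us :: nat list). g (\<lambda>i. if i < length us then us ! i else 0) m)"
  have countV: "countable Vals" unfolding Vals_def by simp
  have PV: "g x m \<in> Vals" if x: "x \<in> P m" for x m
  proof -
    obtain l where l: "\<forall>y. (\<forall>i<l. y i = x i) \<longrightarrow> g y m = g x m"
      using x unfolding P_def mem_Collect_eq by (elim exE)
    have eq: "g (\<lambda>i. if i < length (map x [0..<l]) then map x [0..<l] ! i else 0) m = g x m"
      by (rule l[rule_format]) simp
    show ?thesis
      unfolding Vals_def by (rule range_eqI[of _ _ "(m, map x [0..<l])"]) (simp only: prod.case eq)
  qed
  define Q where "Q a = {x. a \<in> range (g x)}" for a
  \<comment> \<open>If some \<open>{x. g x n = a}\<close> contains a cylinder, every point can be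
    moved into it by changing a prefix; otherwise these closed sets are all nowhere dense.\<close>
  have Q: "Q a = UNIV \<or> comeager (- Q a)" for a
  proof (cases "\<exists>n. interior {x. g x n = a} \<noteq> {}")
    case True
    then obtain n s where s: "s \<in> interior {x. g x n = a}" by blast
    obtain l where l: "\<forall>y. (\<forall>i<l. y i = s i) \<longrightarrow> y \<in> interior {x. g x n = a}"
      by (rule open_contains_cylinder[OF open_interior s])
    have "x \<in> Q a" for x
    proof -
      define y where "y i = (if i < l then s i else x i)" for i
      have "y \<in> {x. g x n = a}"
        using l[THEN spec, of y] interior_subset by (auto simp: y_def)
      moreover have "range (g x) = range (g y)"
        by (rule inv[of l]) (simp add: y_def)
      ultimately show ?thesis unfolding Q_def by blast
    qed
    then show ?thesis by blast
  next
    case False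
    have cl: "closed {x. g x n = a}" for n
      unfolding fun_eq_iff by (intro closed_Collect_all closed_Collect_eq cgn continuous_on_const)
    have "comeager (\<Inter>n. - {x. g x n = a})"
      using False cl by (intro comeager_INT comeager_open_dense) (auto simp: closure_complement simp del: Compl_iff)
    then have "comeager (- Q a)" by (rule comeager_mono) (auto simp: Q_def)
    then show ?thesis by blast
  qed
  define D where "D = (\<Inter>m. P m) \<inter> (\<Inter>a\<in>{a\<in>Vals. Q a \<noteq> UNIV}. - Q a)"
  have "comeager D"
    unfolding D_def by (intro comeager_Int comeager_INT comeager_countable_INT comP)
      (use countV Q in \<open>auto intro: countable_subset[of _ Vals]\<close>)
  moreover have "range (g x) = {a\<in>Vals. Q a = UNIV}" if "x \<in> D" for x
  proof
    show "range (g x) \<subseteq> {a\<in>Vals. Q a = UNIV}"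
    proof
      fix a assume a: "a \<in> range (g x)"
      then have "a \<in> Vals" using PV that unfolding D_def by blast
      moreover have "x \<in> Q a" using a by (simp add: Q_def)
      ultimately show "a \<in> {a\<in>Vals. Q a = UNIV}" using that unfolding D_def by blast
    qed
    show "{a\<in>Vals. Q a = UNIV} \<subseteq> range (g x)"
      unfolding Q_def by blast
  qed
  ultimately show ?thesis by (intro exI[of _ D]) simp
qed

text \<open>Unit steps stay inside a class, so a reduction restricted to a product set would have
  generically constant range. Yet every comeager set contains two points at opposite ends of
  infinitely many coordinates.\<close>

lemma not_reducible_eq_plus:
  fixes E :: "(nat \<Rightarrow> nat) \<Rightarrow> (nat \<Rightarrow> nat) \<Rightarrow> bool" and b :: "nat \<Rightarrow> nat"
  assumes steps: "\<And>x y N. \<forall>k\<ge>N. y k = x k \<or> y k = Suc (x k) \<Longrightarrow> E x y"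
    and ends: "\<And>x y. infinite {k. x k = 0 \<and> y k = b k} \<Longrightarrow> \<not> E x y"
  shows "\<not> E \<le>\<^sub>B eq_plus"
proof
  assume "E \<le>\<^sub>B eq_plus"
  then obtain f :: "(nat \<Rightarrow> nat) \<Rightarrow> nat \<Rightarrow> nat \<Rightarrow> nat"
    where f: "f \<in> measurable borel borel" "\<And>x y. E x y \<longleftrightarrow> range (f x) = range (f y)"
    unfolding borel_reducible_def eq_plus_iff_range_eq by blast
  obtain A z where A: "(\<forall>i::nat. infinite (A \<inter> UNIV)) \<and>
      continuous_on UNIV (\<lambda>x. f (\<lambda>k. if k \<in> A then min (x k) (b k) else z k))"
    using borel_measurable_continuous_on_product[OF f(1), of "\<lambda>_. UNIV" b] by auto
  define h where "h x = (\<lambda>k. if k \<in> A then min (x k) (b k) else z k)" for x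
  have cont: "continuous_on UNIV (\<lambda>x. f (h x))"
    using A unfolding h_def by blast
  \<comment> \<open>Truncation turns a unit step into a unit step or no step, and frozen coordinates
    do not move.\<close>
  have inv: "range (f (h x)) = range (f (h y))" if "\<forall>k\<ge>N. y k = x k \<or> y k = Suc (x k)" for x y N
    unfolding f(2)[symmetric]
    by (rule steps[of N]) (use that in \<open>auto simp: h_def min_def\<close>)
  have "\<exists>D. comeager D \<and> (\<forall>x\<in>D. \<forall>y\<in>D. range (f (h x)) = range (f (h y)))"
    using cont inv by (rule generically_constant_range)
  then obtain D where D: "comeager D" "\<And>x y. x \<in> D \<Longrightarrow> y \<in> D \<Longrightarrow> range (f (h x)) = range (f (h y))"
    by blast
  \<comment> \<open>Taking \<open>A\<close> for the sets to be met makes infinitely many of the new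
    free coordinates survive \<open>h\<close>, which freezes everything outside
    \<open>A\<close>.\<close>
  obtain A' z' where A': "(\<forall>i::nat. infinite (A' \<inter> A)) \<and>
    (\<forall>x. (\<forall>k. x k \<le> b k) \<longrightarrow> (\<lambda>k. if k \<in> A' then x k else z' k) \<in> D)"
    using comeager_contains_product[OF D(1), of "\<lambda>_. A" b] A by auto
  define x y where "x = (\<lambda>k. if k \<in> A' then 0 else z' k)" and "y = (\<lambda>k. if k \<in> A' then b k else z' k)"
  have "x \<in> D" "y \<in> D"
    unfolding x_def y_def using A' by (auto intro: A'[THEN conjunct2, rule_format])
  then have "E (h x) (h y)" using D(2) f(2) by blast
  moreover have "A' \<inter> A \<subseteq> {k. h x k = 0 \<and> h y k = b k}"
    by (auto simp: h_def x_def y_def)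
  then have "infinite {k. h x k = 0 \<and> h y k = b k}"
    using A' infinite_super by blast
  ultimately show False using ends by blast
qed

section \<open>Reductions of equivalence relations of Polish groups\<close>

text \<open>A terminating and complete rewrite system for the free group.\<close>

lemmas group_add_normalize = diff_conv_add_uminus minus_add minus_minus minus_zero add.assoc
  minus_add_cancel add_minus_cancel right_minus left_minus add_0_left add_0_right

text \<open>Raikov completeness. The dense open set \<open>P k\<close> below consists of the \<open>u\<close> with a neighbourhood that
  all but finitely many left translations by \<open>w m\<close> map into one ball of radius \<open>1 / (k + 1)\<close>.\<close>

lemma two_sided_Cauchy_convergent:
  fixes w :: "nat \<Rightarrow> 'a::{topological_group_add, complete_space}"
  assumes left: "\<And>U. open U \<Longrightarrow> 0 \<in> U \<Longrightarrow> \<exists>N. \<forall>m\<ge>N. \<forall>n\<ge>N. - w m + w n \<in> U"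
    and right: "\<And>U. open U \<Longrightarrow> 0 \<in> U \<Longrightarrow> \<exists>N. \<forall>m\<ge>N. \<forall>n\<ge>N. w m - w n \<in> U"
  shows "convergent w"
proof -
  define P where "P k = {u. \<exists>N V p. open V \<and> u \<in> V \<and> (\<forall>m\<ge>N. \<forall>v\<in>V. dist p (w m + v) < 1 / real (Suc k))}"
    for k
  have "comeager (P k)" for k
  proof (rule comeager_open_dense)
    show "open (P k)"
    proof (subst open_subopen, intro ballI)
      fix u assume "u \<in> P k"
      then obtain N V p where V: "open V" "u \<in> V" "\<forall>m\<ge>N. \<forall>v\<in>V. dist p (w m + v) < 1 / real (Suc k)"
        unfolding P_def by blast
      then have "V \<subseteq> P k" unfolding P_def by blast
      then show "\<exists>T. open T \<and> u \<in> T \<and> T \<subseteq> P k" using V by blast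
    qed
    have "U \<inter> P k \<noteq> {}" if U: "open U" "u \<in> U" for U u
    proof -
      have "open ((\<lambda>v. v + u) -` U)"
        by (intro open_vimage U continuous_intros)
      moreover have "0 \<in> (\<lambda>v. v + u) -` U" using U by simp
      ultimately obtain N where "\<forall>m\<ge>N. \<forall>n\<ge>N. - w m + w n \<in> (\<lambda>v. v + u) -` U"
        using left by blast
      then have N: "- w m + w N + u \<in> U" if "m \<ge> N" for m
        using that by simp
      \<comment> \<open>By the left Cauchy condition, the point \<open>- w M + p\<close> that
        translation by \<open>w M\<close> sends to \<open>p\<close> lies in \<open>U\<close> for all
        large \<open>M\<close>.\<close>
      define p where "p = w N + u"
      have "((\<lambda>x. fst x + snd x) \<longlongrightarrow> 0 + p) (nhds 0 \<times>\<^sub>F nhds p)"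
        by (rule tendsto_add_Pair)
      moreover have "open (ball p (1 / real (Suc k)))" "0 + p \<in> ball p (1 / real (Suc k))" by auto
      ultimately have "eventually (\<lambda>x. fst x + snd x \<in> ball p (1 / real (Suc k))) (nhds 0 \<times>\<^sub>F nhds p)"
        by (rule topological_tendstoD)
      then obtain Pf Pg where PQ: "eventually Pf (nhds 0)" "eventually Pg (nhds p)"
        "\<And>x y. Pf x \<Longrightarrow> Pg y \<Longrightarrow> x + y \<in> ball p (1 / real (Suc k))"
        unfolding eventually_prod_filter by auto
      obtain S T where S: "open S" "0 \<in> S" "\<And>x. x \<in> S \<Longrightarrow> Pf x"
        and T: "open T" "p \<in> T" "\<And>x. x \<in> T \<Longrightarrow> Pg x"
        using PQ(1,2) unfolding eventually_nhds by metis
      \<comment> \<open>The right Cauchy condition absorbs the factor \<open>w m - w M\<close> when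
        \<open>w m + v\<close> is compared with \<open>w M + v\<close>, which is near
        \<open>p\<close>.\<close>
      obtain N' where N': "\<forall>m\<ge>N'. \<forall>n\<ge>N'. w m - w n \<in> S"
        using right[OF S(1,2)] by blast
      define M where "M = max N N'"
      define V where "V = (\<lambda>v. w M + v) -` T"
      have "open V" unfolding V_def by (intro open_vimage T continuous_intros)
      moreover have "- w M + p \<in> V" using T by (simp add: V_def)
      moreover have "dist p (w m + v) < 1 / real (Suc k)" if "m \<ge> M" "v \<in> V" for m v
      proof -
        have "w m - w M \<in> S" using N' that(1) by (auto simp: M_def)
        moreover have "w M + v \<in> T" using that(2) by (simp add: V_def)
        ultimately have "(w m - w M) + (w M + v) \<in> ball p (1 / real (Suc k))"
          using S(3) T(3) PQ(3) by blast
        moreover have "(w m - w M) + (w M + v) = w m + v"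
          by (simp only: group_add_normalize)
        ultimately show ?thesis by simp
      qed
      ultimately have "- w M + p \<in> P k" unfolding P_def by blast
      moreover have "- w M + p \<in> U"
        using N[of M] by (simp add: p_def M_def add.assoc)
      ultimately show ?thesis by blast
    qed
    then have "- closure (P k) \<inter> P k \<noteq> {}" if "u \<in> - closure (P k)" for u
      using that by (meson closed_closure open_Compl)
    then show "closure (P k) = UNIV"
      using closure_subset[of "P k"] by auto
  qed
  then have "comeager (\<Inter>k. P k)" by (rule comeager_INT)
  then have "closure (\<Inter>k. P k) = UNIV"
    by (rule comeager_dense[OF completely_metrizable_space_euclidean])
  then have "(\<Inter>k. P k) \<noteq> {}" by force
  then obtain u where u: "\<And>k. u \<in> P k" by blast
  have "Cauchy (\<lambda>n. w n + u)"
    unfolding Cauchy_def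
  proof (intro allI impI)
    fix e :: real assume "e > 0"
    then obtain k where k: "1 / real (Suc k) < e / 2" using nat_approx_posE[of "e / 2"] by auto
    obtain N V p where "open V" "u \<in> V" "\<forall>m\<ge>N. \<forall>v\<in>V. dist p (w m + v) < 1 / real (Suc k)"
      using u[of k] unfolding P_def by blast
    then have N: "dist p (w m + u) < e / 2" if "m \<ge> N" for m using that k by force
    have "dist (w m + u) (w n + u) < e" if "m \<ge> N" "n \<ge> N" for m n
      using N[OF that(1)] N[OF that(2)] by (rule dist_triangle_half_r)
    then show "\<exists>M. \<forall>m\<ge>M. \<forall>n\<ge>M. dist (w m + u) (w n + u) < e" by blast
  qed
  then obtain L where "(\<lambda>n. w n + u) \<longlonglongrightarrow> L"
    using Cauchy_convergent convergent_def by blast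
  then have "(\<lambda>n. w n + u + - u) \<longlonglongrightarrow> L + - u" by (intro tendsto_intros)
  then show ?thesis by (auto simp: convergent_def add.assoc)
qed

section \<open>Coset codes of open subgroups and the upper bounds\<close>

lemma add_subgroup_diff: "add_subgroup H \<Longrightarrow> x \<in> H \<Longrightarrow> y \<in> H \<Longrightarrow> x - y \<in> H"
  unfolding add_subgroup_def by (metis add_uminus_conv_diff)

lemma group_equiv_sym:
  fixes x y :: "nat \<Rightarrow> 'a::topological_group_add"
  assumes "group_equiv TYPE('a) x y"
  shows "group_equiv TYPE('a) y x"
proof -
  obtain L where "(\<lambda>n. x n - y n) \<longlonglongrightarrow> L"
    using assms unfolding group_equiv_def convergent_def by blast
  then have "(\<lambda>n. - (x n - y n)) \<longlonglongrightarrow> - L" by (rule tendsto_minus)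
  then show ?thesis unfolding group_equiv_def convergent_def by auto
qed

lemma convergent_imp_right_Cauchy:
  fixes w :: "nat \<Rightarrow> 'a::topological_group_add"
  assumes "convergent w" "open H" "add_subgroup H"
  shows "\<exists>N. \<forall>m\<ge>N. \<forall>n\<ge>N. w m - w n \<in> H"
proof -
  obtain L where "w \<longlonglongrightarrow> L" using assms(1) unfolding convergent_def by blast
  then have "(\<lambda>n. w n - L) \<longlonglongrightarrow> L - L" by (intro tendsto_intros)
  moreover have "L - L \<in> H" using assms(3) by (simp add: add_subgroup_def)
  ultimately have "eventually (\<lambda>n. w n - L \<in> H) sequentially"
    using assms(2) topological_tendstoD by blast
  then obtain N where N: "\<And>n. n \<ge> N \<Longrightarrow> w n - L \<in> H"
    unfolding eventually_sequentially by blast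
  have "w m - w n \<in> H" if "m \<ge> N" "n \<ge> N" for m n
    using add_subgroup_diff[OF assms(3) N[OF that(1)] N[OF that(2)]] by (simp only: group_add_normalize)
  then show ?thesis by blast
qed

text \<open>The cosets \<open>H + x\<close> are open, so a dense sequence meets each of them. The
  code is the first index at which this happens; it is constant on cosets, hence continuous, and
  \<open>d\<close> returns a representative.\<close>

lemma open_subgroup_coset_code:
  fixes H :: "'a::{topological_group_add, second_countable_topology} set"
  assumes H: "open H" "add_subgroup H"
  shows "\<exists>(c :: 'a \<Rightarrow> nat) d. continuous_on UNIV c \<and> (\<forall>x y. c x = c y \<longleftrightarrow> x - y \<in> H) \<and>
    (\<forall>x. x - d (c x) \<in> H)"
proof -
  obtain D :: "'a set" where D: "countable D" "\<And>X. open X \<Longrightarrow> X \<noteq> {} \<Longrightarrow> \<exists>d\<in>D. d \<in> X"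
    using countable_dense_setE by blast
  define d where "d = from_nat_into D"
  have ex: "\<exists>i. x - d i \<in> H" for x
  proof -
    have "open ((\<lambda>v. x - v) -` H)" by (intro open_vimage H continuous_intros)
    moreover have "x \<in> (\<lambda>v. x - v) -` H" using H by (simp add: add_subgroup_def)
    ultimately obtain v where "v \<in> D" "x - v \<in> H" using D(2) by blast
    then show ?thesis unfolding d_def using D(1) by (metis from_nat_into_surj)
  qed
  define c where "c x = (LEAST i. x - d i \<in> H)" for x
  have cd: "x - d (c x) \<in> H" for x
    unfolding c_def using ex by (rule LeastI_ex)
  have shift: "x - v \<in> H \<longleftrightarrow> y - v \<in> H" if "x - y \<in> H" for x y v
  proof
    assume "y - v \<in> H"
    then have "(x - y) + (y - v) \<in> H" using that H(2) unfolding add_subgroup_def by blast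
    then show "x - v \<in> H" by (simp only: group_add_normalize)
  next
    assume "x - v \<in> H"
    then have "- (x - y) + (x - v) \<in> H" using that H(2) unfolding add_subgroup_def by blast
    then show "y - v \<in> H" by (simp only: group_add_normalize)
  qed
  have c_iff: "c x = c y \<longleftrightarrow> x - y \<in> H" for x y
  proof
    assume "c x = c y"
    then have "(x - d (c x)) - (y - d (c x)) \<in> H"
      using add_subgroup_diff[OF H(2) cd[of x] cd[of y]] by simp
    then show "x - y \<in> H" by (simp only: group_add_normalize)
  next
    assume "x - y \<in> H"
    then show "c x = c y" unfolding c_def by (simp only: shift[of x y])
  qed
  have "open (c -` B)" for B
  proof (subst open_subopen, intro ballI)
    fix y assume y: "y \<in> c -` B"
    have "open ((\<lambda>x. x - y) -` H)" by (intro open_vimage H continuous_intros)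
    moreover have "y \<in> (\<lambda>x. x - y) -` H" using H by (simp add: add_subgroup_def)
    moreover have "(\<lambda>x. x - y) -` H \<subseteq> c -` B" using y by (auto simp flip: c_iff)
    ultimately show "\<exists>T. open T \<and> y \<in> T \<and> T \<subseteq> c -` B" by blast
  qed
  then have "continuous_on UNIV c" by (simp add: continuous_on_open_vimage)
  then show ?thesis using c_iff cd by (intro exI[of _ c] exI[of _ d]) simp
qed

text \<open>If \<open>x n - y n\<close> tends to \<open>g\<close>, then \<open>H + h + x n\<close>
  eventually equals \<open>H + h' + y n\<close> for any representative \<open>h'\<close> of
  \<open>H + h + g\<close>, so \<open>x\<close> and \<open>y\<close> yield the same set of modified
  coset sequences. Conversely, for \<open>h\<close> in \<open>H\<close> a common member gives the
  right Cauchy condition modulo \<open>H\<close>.\<close>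

lemma non_archimedean_reducible_eq_plus:
  assumes "non_archimedean TYPE('a::{topological_group_add, polish_space})"
  shows "group_equiv TYPE('a) \<le>\<^sub>B eq_plus"
proof -
  obtain A :: "nat \<Rightarrow> 'a set" where A: "\<And>k. open (A k)" "\<And>k. 0 \<in> A k"
      "\<And>S. open S \<Longrightarrow> 0 \<in> S \<Longrightarrow> eventually (\<lambda>k. A k \<subseteq> S) sequentially"
    using countable_basis_at_decseq[of "0::'a"] by blast
  have "\<forall>k. \<exists>H. open H \<and> add_subgroup H \<and> H \<subseteq> A k"
    using assms A(1,2) unfolding non_archimedean_def by blast
  then obtain H where H: "\<And>k. open (H k)" "\<And>k. add_subgroup (H k)" "\<And>k. H k \<subseteq> A k"
    by metis
  have base: "\<exists>k. H k \<subseteq> U" if "open U" "0 \<in> U" for U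
    using A(3)[OF that] H(3) unfolding eventually_sequentially by blast
  have "\<forall>k. \<exists>(c :: 'a \<Rightarrow> nat) d. continuous_on UNIV c \<and> (\<forall>x y. c x = c y \<longleftrightarrow> x - y \<in> H k) \<and>
      (\<forall>x. x - d (c x) \<in> H k)"
    using open_subgroup_coset_code[OF H(1,2)] by (rule allI)
  then obtain c and d :: "nat \<Rightarrow> nat \<Rightarrow> 'a" where c: "\<And>k. continuous_on UNIV (c k)"
      "\<And>k x y. (c k x :: nat) = c k y \<longleftrightarrow> x - y \<in> H k" "\<And>k x. x - d k (c k x) \<in> H k"
    by metis
  \<comment> \<open>The first entry \<open>k\<close> keeps the invariants of different subgroups apart.\<close>
  define F where "F = (\<lambda>(k, i, us :: nat list) (x :: nat \<Rightarrow> 'a) n.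
      case n of 0 \<Rightarrow> k | Suc j \<Rightarrow> if j < length us then us ! j else c k (d k i + x j))"
  have F0: "F (k, i, us) x 0 = k" and FSuc: "F (k, i, us) x (Suc j) =
      (if j < length us then us ! j else c k (d k i + x j))" for k i us x j
    by (simp_all add: F_def)
  define f where "f x p = F (from_nat p) x" for x p
  have range_f: "range (f x) = range (\<lambda>p. F p x)" for x
  proof -
    have "range (f x) = (\<lambda>p. F p x) ` range from_nat"
      unfolding f_def by (simp only: image_image)
    then show ?thesis by (simp only: surj_from_nat)
  qed
  have "continuous_on UNIV (\<lambda>x. F p x n)" for p n
  proof -
    obtain k i us where p: "p = (k, i, us)" by (cases p)
    show ?thesis
    proof (cases n)
      case 0
      then show ?thesis by (simp add: p F0)
    next
      case (Suc j)
      have "continuous_on UNIV (\<lambda>x. c k (d k i + x j))"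
        by (rule continuous_on_compose2[OF c(1)]) (auto intro!: continuous_intros)
      then show ?thesis by (cases "j < length us") (simp_all add: p Suc FSuc)
    qed
  qed
  then have "continuous_on UNIV f"
    unfolding f_def by (intro continuous_on_coordinatewise_then_product)
  then have meas: "f \<in> measurable borel borel" by (rule borel_measurable_continuous_onI)
  have c_eq: "c k (a + x) = c k (b + y) \<longleftrightarrow> a + (x - y) - b \<in> H k" for k a b x y
    unfolding c(2) by (simp only: group_add_normalize)
  have sub: "range (f x) \<subseteq> range (f y)" if xy: "group_equiv TYPE('a) x y" for x y
  proof -
    obtain g where g: "(\<lambda>n. x n - y n) \<longlonglongrightarrow> g"
      using xy unfolding group_equiv_def convergent_def by blast
    have "\<exists>q. F p x = F q y" for p
    proof -
      obtain k i us where p: "p = (k, i, us)" by (cases p)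
      define i' where "i' = c k (d k i + g)"
      have "(\<lambda>n. d k i + (x n - y n) - d k i') \<longlonglongrightarrow> d k i + g - d k i'"
        using g by (intro tendsto_intros)
      moreover have "d k i + g - d k i' \<in> H k" using c(3) by (simp add: i'_def)
      ultimately have "eventually (\<lambda>n. d k i + (x n - y n) - d k i' \<in> H k) sequentially"
        using H(1) topological_tendstoD by blast
      then obtain N where N: "\<And>n. n \<ge> N \<Longrightarrow> c k (d k i + x n) = c k (d k i' + y n)"
        unfolding eventually_sequentially c_eq by blast
      \<comment> \<open>\<open>us'\<close> records all entries before the two coset sequences agree,
        and also covers the modification \<open>us\<close> already present.\<close>
      define us' where "us' = map (\<lambda>j. F p x (Suc j)) [0..<max N (length us)]"
      have "F p x n = F (k, i', us') y n" for n
        by (cases n) (auto simp: p F0 FSuc us'_def N)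
      then show ?thesis by blast
    qed
    then show ?thesis unfolding range_f by (auto simp: image_iff)
  qed
  have cau: "\<exists>N. \<forall>m\<ge>N. \<forall>n\<ge>N. (x m - y m) - (x n - y n) \<in> H k" if "range (f x) \<subseteq> range (f y)" for x y k
  proof -
    \<comment> \<open>Starting from the coset of \<open>0\<close> gives
      \<open>d k i \<in> H k\<close>, so this term can be cancelled on the left.\<close>
    define i where "i = c k 0"
    have "- d k i \<in> H k" using c(3)[of 0 k] by (simp add: i_def)
    then have dH: "d k i \<in> H k" using H(2)[of k] unfolding add_subgroup_def by force
    have "F (k, i, []) x \<in> range (\<lambda>p. F p y)"
      using that unfolding range_f by blast
    then obtain k' i' us where q: "F (k, i, []) x = F (k', i', us) y" by (auto simp: image_iff)
    have k': "k' = k" using fun_cong[OF q, of 0] by (simp add: F0)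
    have wH: "(x n - y n) - d k i' \<in> H k" if "n \<ge> length us" for n
    proof -
      have "c k (d k i + x n) = c k (d k i' + y n)"
        using fun_cong[OF q, of "Suc n"] that by (simp add: FSuc k')
      then have "d k i + (x n - y n) - d k i' \<in> H k" by (simp add: c_eq)
      then have "- d k i + (d k i + (x n - y n) - d k i') \<in> H k"
        using dH H(2)[of k] unfolding add_subgroup_def by blast
      then show ?thesis by (simp only: group_add_normalize)
    qed
    have "(x m - y m) - (x n - y n) \<in> H k" if "m \<ge> length us" "n \<ge> length us" for m n
      using add_subgroup_diff[OF H(2)[of k] wH[OF that(1)] wH[OF that(2)]] by (simp only: group_add_normalize)
    then show ?thesis by blast
  qed
  have "group_equiv TYPE('a) x y \<longleftrightarrow> eq_plus (f x) (f y)" for x y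
  proof
    assume "group_equiv TYPE('a) x y"
    then show "eq_plus (f x) (f y)"
      using sub[of x y] sub[of y x] group_equiv_sym unfolding eq_plus_iff_range_eq by blast
  next
    assume "eq_plus (f x) (f y)"
    then have r: "range (f x) \<subseteq> range (f y)" "range (f y) \<subseteq> range (f x)"
      unfolding eq_plus_iff_range_eq by auto
    have "convergent (\<lambda>n. x n - y n)"
    proof (rule two_sided_Cauchy_convergent)
      fix U :: "'a set" assume U: "open U" "0 \<in> U"
      then obtain k where k: "H k \<subseteq> U" using base by blast
      show "\<exists>N. \<forall>m\<ge>N. \<forall>n\<ge>N. (x m - y m) - (x n - y n) \<in> U"
        using cau[OF r(1), of k] k by blast
      \<comment> \<open>The right Cauchy condition for \<open>y n - x n\<close> is the left one for
        \<open>x n - y n\<close>; this is where the second inclusion of ranges enters.\<close>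
      have "\<exists>N. \<forall>m\<ge>N. \<forall>n\<ge>N. (y m - x m) - (y n - x n) \<in> U"
        using cau[OF r(2), of k] k by blast
      then show "\<exists>N. \<forall>m\<ge>N. \<forall>n\<ge>N. - (x m - y m) + (x n - y n) \<in> U"
        by (simp only: group_add_normalize)
    qed
    then show "group_equiv TYPE('a) x y" unfolding group_equiv_def .
  qed
  then show ?thesis unfolding borel_reducible_def using meas by blast
qed

text \<open>Conjugation by \<open>x n\<close> carries the difference of the increments
  \<open>- x n + x (Suc n)\<close> and \<open>- y n + y (Suc n)\<close> to
  \<open>(x (Suc n) - y (Suc n)) - (x n - y n)\<close>. For normal \<open>H\<close> the latter lies
  in \<open>H\<close> exactly when the coset codes of the increments agree.\<close>

lemma E0_code_of_normal_subgroup: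
  fixes H :: "'a::{topological_group_add, second_countable_topology} set"
  assumes H: "open H" "add_subgroup H" and normal: "\<And>g h. h \<in> H \<Longrightarrow> g + h - g \<in> H"
  shows "\<exists>r :: (nat \<Rightarrow> 'a) \<Rightarrow> nat \<Rightarrow> bool. continuous_on UNIV r \<and>
    (\<forall>x y. E0 (r x) (r y) \<longleftrightarrow> (\<exists>N. \<forall>m\<ge>N. \<forall>n\<ge>N. (x m - y m) - (x n - y n) \<in> H))"
proof -
  obtain c :: "'a \<Rightarrow> nat" where c: "continuous_on UNIV c" "\<And>x y. c x = c y \<longleftrightarrow> x - y \<in> H"
    using open_subgroup_coset_code[OF H] by blast
  define a where "a x n = c (- x n + x (Suc n))" for x :: "nat \<Rightarrow> 'a" and n
  \<comment> \<open>\<open>r x\<close> is the graph of \<open>a x\<close>: for such graphs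
    \<open>E0\<close> says that the two sequences eventually agree.\<close>
  define r where "r x j = (a x (fst (prod_decode j)) = snd (prod_decode j))" for x j
  have ca: "continuous_on UNIV (\<lambda>x. a x n)" for n
    unfolding a_def by (rule continuous_on_compose2[OF c(1)]) (auto intro!: continuous_intros)
  have "continuous_on UNIV r"
    unfolding r_def by (intro continuous_on_coordinatewise_then_product
      continuous_on_discrete_compose[where g = "\<lambda>v. v = snd (prod_decode j)" for j] ca)
  have E0_a: "E0 (r x) (r y) \<longleftrightarrow> (\<exists>N. \<forall>n\<ge>N. a x n = a y n)" for x y
  proof
    assume "E0 (r x) (r y)"
    then obtain J where J: "\<And>j. j > J \<Longrightarrow> r x j = r y j" unfolding E0_def by blast
    have "a x n = a y n" if "n \<ge> Suc J" for n
    proof -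
      have "prod_encode (n, a x n) > J"
        using that le_prod_encode_1[of n "a x n"] by linarith
      from J[OF this] show ?thesis by (simp add: r_def)
    qed
    then show "\<exists>N. \<forall>n\<ge>N. a x n = a y n" by blast
  next
    assume "\<exists>N. \<forall>n\<ge>N. a x n = a y n"
    then obtain N where N: "\<And>n. n \<ge> N \<Longrightarrow> a x n = a y n" by blast
    \<comment> \<open>From \<open>N\<close> on the graphs coincide, so \<open>B\<close> contains
      every place at which they can differ.\<close>
    define B where "B = (\<lambda>n. prod_encode (n, a x n)) ` {..<N} \<union> (\<lambda>n. prod_encode (n, a y n)) ` {..<N}"
    have "finite B" unfolding B_def by simp
    then obtain J where J: "\<And>j. j \<in> B \<Longrightarrow> j \<le> J"
      unfolding finite_nat_set_iff_bounded_le by blast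
    have "r x j = r y j" if "j > J" for j
    proof -
      obtain n v where j: "j = prod_encode (n, v)" by (metis prod_decode_inverse surj_pair)
      have "j \<notin> B" using J[of j] that by fastforce
      then show ?thesis using N[of n] by (cases "n < N") (auto simp: r_def j B_def)
    qed
    then show "E0 (r x) (r y)" unfolding E0_def by blast
  qed
  have normal': "g + h - g \<in> H \<longleftrightarrow> h \<in> H" for g h
  proof
    assume "g + h - g \<in> H"
    then have "- g + (g + h - g) - - g \<in> H" by (rule normal)
    then show "h \<in> H" by (simp only: group_add_normalize)
  qed (rule normal)
  have a_iff: "a x n = a y n \<longleftrightarrow> (x (Suc n) - y (Suc n)) - (x n - y n) \<in> H" for x y n
  proof -
    have "x n + ((- x n + x (Suc n)) - (- y n + y (Suc n))) - x n = (x (Suc n) - y (Suc n)) - (x n - y n)"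
      by (simp only: group_add_normalize)
    then show ?thesis unfolding a_def c(2) using normal' by metis
  qed
  have "(\<exists>N. \<forall>n\<ge>N. a x n = a y n) \<longleftrightarrow> (\<exists>N. \<forall>m\<ge>N. \<forall>n\<ge>N. (x m - y m) - (x n - y n) \<in> H)" for x y
  proof
    assume "\<exists>N. \<forall>n\<ge>N. a x n = a y n"
    then obtain N where N: "\<And>n. n \<ge> N \<Longrightarrow> (x (Suc n) - y (Suc n)) - (x n - y n) \<in> H"
      unfolding a_iff by blast
    have base: "(x m - y m) - (x N - y N) \<in> H" if "m \<ge> N" for m
      using that
    proof (induction m rule: dec_induct)
      case base
      then show ?case using H(2) by (simp add: add_subgroup_def)
    next
      case (step n)
      have "((x (Suc n) - y (Suc n)) - (x n - y n)) + ((x n - y n) - (x N - y N)) \<in> H"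
        using N[OF step(1)] step(3) H(2) unfolding add_subgroup_def by blast
      then show ?case by (simp only: group_add_normalize)
    qed
    have "(x m - y m) - (x n - y n) \<in> H" if "m \<ge> N" "n \<ge> N" for m n
      using add_subgroup_diff[OF H(2) base[OF that(1)] base[OF that(2)]] by (simp only: group_add_normalize)
    then show "\<exists>N. \<forall>m\<ge>N. \<forall>n\<ge>N. (x m - y m) - (x n - y n) \<in> H" by blast
  next
    assume "\<exists>N. \<forall>m\<ge>N. \<forall>n\<ge>N. (x m - y m) - (x n - y n) \<in> H"
    then show "\<exists>N. \<forall>n\<ge>N. a x n = a y n" unfolding a_iff by (meson le_Suc_eq)
  qed
  then show ?thesis using \<open>continuous_on UNIV r\<close> E0_a by (intro exI[of _ r]) simp
qed

text \<open>In a discrete group \<open>{0}\<close> is an open normal subgroup, and being Cauchy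
  modulo \<open>{0}\<close> means being eventually constant.\<close>

lemma discrete_reducible_E0:
  assumes "discrete_space TYPE('a::{topological_group_add, second_countable_topology})"
  shows "group_equiv TYPE('a) \<le>\<^sub>B E0"
proof -
  have H: "open {0::'a}" "add_subgroup {0::'a}" "\<And>g h. h \<in> {0::'a} \<Longrightarrow> g + h - g \<in> {0}"
    using assms by (auto simp: discrete_space_def add_subgroup_def)
  obtain r :: "(nat \<Rightarrow> 'a) \<Rightarrow> nat \<Rightarrow> bool" where r: "continuous_on UNIV r"
    "\<And>x y. E0 (r x) (r y) \<longleftrightarrow> (\<exists>N. \<forall>m\<ge>N. \<forall>n\<ge>N. (x m - y m) - (x n - y n) \<in> {0})"
    using E0_code_of_normal_subgroup[OF H] by blast
  have "group_equiv TYPE('a) x y \<longleftrightarrow> E0 (r x) (r y)" for x y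
  proof
    assume "group_equiv TYPE('a) x y"
    then show "E0 (r x) (r y)"
      unfolding r(2) group_equiv_def by (rule convergent_imp_right_Cauchy[OF _ H(1,2)])
  next
    assume "E0 (r x) (r y)"
    then obtain N where N: "\<And>m n. m \<ge> N \<Longrightarrow> n \<ge> N \<Longrightarrow> (x m - y m) - (x n - y n) \<in> {0}"
      unfolding r(2) by blast
    have "eventually (\<lambda>n. x N - y N = x n - y n) sequentially"
      unfolding eventually_sequentially using N[of N] by auto
    then have "(\<lambda>n. x n - y n) \<longlonglongrightarrow> x N - y N"
      by (rule Lim_transform_eventually[OF tendsto_const])
    then show "group_equiv TYPE('a) x y" unfolding group_equiv_def convergent_def by blast
  qed
  then show ?thesis
    unfolding borel_reducible_def using borel_measurable_continuous_onI[OF r(1)] by blast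
qed

lemma TSI_normal_subgroup:
  fixes U :: "'a::topological_group_add set"
  assumes "TSI TYPE('a)" "non_archimedean TYPE('a)" "open U" "0 \<in> U"
  shows "\<exists>N. open N \<and> add_subgroup N \<and> N \<subseteq> U \<and> (\<forall>g. \<forall>h\<in>N. g + h - g \<in> N)"
proof -
  obtain H where H: "open H" "add_subgroup H" "H \<subseteq> U"
    using assms(2-4) unfolding non_archimedean_def by blast
  obtain d :: "'a \<Rightarrow> 'a \<Rightarrow> real" where d: "Metric_space UNIV d" "Metric_space.mtopology UNIV d = euclidean"
      "\<And>g h x y. d (g + x + h) (g + y + h) = d x y"
    using assms(1) unfolding TSI_def by blast
  interpret Metric_space UNIV d by (rule d(1))
  have "openin mtopology H" using H(1) d(2) by simp
  moreover have "0 \<in> H" using H(2) by (simp add: add_subgroup_def)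
  ultimately obtain e where e: "e > 0" "mball 0 e \<subseteq> H" unfolding openin_mtopology by blast
  \<comment> \<open>The normal core of \<open>H\<close>; it is open since it contains the conjugation-invariant ball in \<open>H\<close>.\<close>
  define N where "N = {x. \<forall>g. g + x - g \<in> H}"
  have ballN: "mball 0 e \<subseteq> N"
  proof
    fix x assume "x \<in> mball 0 e"
    moreover have "d 0 (g + x - g) = d 0 x" for g
      using d(3)[of g 0 "- g" x] by simp
    ultimately have "g + x - g \<in> mball 0 e" for g by simp
    then show "x \<in> N" unfolding N_def using e(2) by blast
  qed
  have subN: "add_subgroup N"
    unfolding add_subgroup_def
  proof (intro conjI ballI)
    show "0 \<in> N" using H(2) by (simp add: N_def add_subgroup_def)
  next
    fix x y assume xy: "x \<in> N" "y \<in> N"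
    have "g + (x + y) - g \<in> H" for g
    proof -
      have "(g + x - g) + (g + y - g) \<in> H"
        using xy H(2) unfolding N_def add_subgroup_def by blast
      then show ?thesis by (simp only: group_add_normalize)
    qed
    then show "x + y \<in> N" by (simp add: N_def)
  next
    fix x assume x: "x \<in> N"
    have "g + - x - g \<in> H" for g
    proof -
      have "- (g + x - g) \<in> H"
        using x H(2) unfolding N_def add_subgroup_def by blast
      then show ?thesis by (simp only: group_add_normalize)
    qed
    then show "- x \<in> N" by (simp add: N_def)
  qed
  have "open (mball 0 e)" using openin_mball[of 0 e] d(2) by simp
  have "open N"
  proof (subst open_subopen, intro ballI)
    fix x assume x: "x \<in> N"
    have "open ((\<lambda>y. y - x) -` mball 0 e)"
      by (intro open_vimage \<open>open (mball 0 e)\<close> continuous_intros)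
    moreover have "x \<in> (\<lambda>y. y - x) -` mball 0 e" using e(1) by simp
    moreover have "(\<lambda>y. y - x) -` mball 0 e \<subseteq> N"
    proof
      fix y assume "y \<in> (\<lambda>y. y - x) -` mball 0 e"
      then have "y - x \<in> N" using ballN by blast
      then have "(y - x) + x \<in> N" using x subN unfolding add_subgroup_def by blast
      then show "y \<in> N" by simp
    qed
    ultimately show "\<exists>T. open T \<and> x \<in> T \<and> T \<subseteq> N" by blast
  qed
  moreover have "N \<subseteq> U"
  proof
    fix x assume "x \<in> N"
    then have "0 + x - 0 \<in> H" unfolding N_def by blast
    then show "x \<in> U" using H(3) by auto
  qed
  moreover have "g + h - g \<in> N" if "h \<in> N" for g h
  proof -
    have "g' + (g + h - g) - g' \<in> H" for g'
    proof -
      have "(g' + g) + h - (g' + g) \<in> H" using that unfolding N_def by blast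
      then show ?thesis by (simp only: group_add_normalize)
    qed
    then show ?thesis by (simp add: N_def)
  qed
  ultimately show ?thesis using subN by blast
qed

text \<open>A neighbourhood base of normal open subgroups \<open>H k\<close> gives one instance of
  \<open>E0\<close> for each \<open>k\<close>; together they express the right Cauchy
  condition.\<close>

lemma TSI_non_archimedean_reducible:
  assumes "TSI TYPE('a::{topological_group_add, polish_space})" "non_archimedean TYPE('a)"
  shows "group_equiv TYPE('a) \<le>\<^sub>B omega_power E0"
proof -
  obtain A :: "nat \<Rightarrow> 'a set" where A: "\<And>k. open (A k)" "\<And>k. 0 \<in> A k"
      "\<And>S. open S \<Longrightarrow> 0 \<in> S \<Longrightarrow> eventually (\<lambda>k. A k \<subseteq> S) sequentially"
    using countable_basis_at_decseq[of "0::'a"] by blast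
  have "\<forall>k. \<exists>H. open H \<and> add_subgroup H \<and> H \<subseteq> A k \<and> (\<forall>g. \<forall>h\<in>H. g + h - g \<in> H)"
    using TSI_normal_subgroup[OF assms A(1,2)] by blast
  then obtain H where H: "\<And>k. open (H k)" "\<And>k. add_subgroup (H k)" "\<And>k. H k \<subseteq> A k"
      "\<And>k g h. h \<in> H k \<Longrightarrow> g + h - g \<in> H k"
    by metis
  have base: "\<exists>k. H k \<subseteq> U" if "open U" "0 \<in> U" for U
    using A(3)[OF that] H(3) unfolding eventually_sequentially by blast
  have "\<exists>r :: (nat \<Rightarrow> 'a) \<Rightarrow> nat \<Rightarrow> bool. continuous_on UNIV r \<and> (\<forall>x y. E0 (r x) (r y) \<longleftrightarrow>
      (\<exists>N. \<forall>m\<ge>N. \<forall>n\<ge>N. (x m - y m) - (x n - y n) \<in> H k))" for k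
    by (rule E0_code_of_normal_subgroup[OF H(1,2,4)])
  then obtain r :: "nat \<Rightarrow> (nat \<Rightarrow> 'a) \<Rightarrow> nat \<Rightarrow> bool" where r: "\<And>k. continuous_on UNIV (r k)" "\<And>k x y. E0 (r k x) (r k y) \<longleftrightarrow>
      (\<exists>N. \<forall>m\<ge>N. \<forall>n\<ge>N. (x m - y m) - (x n - y n) \<in> H k)"
    by metis
  define f where "f x k = r k x" for x k
  have "continuous_on UNIV f"
    unfolding f_def by (intro continuous_on_coordinatewise_then_product r(1))
  moreover have "group_equiv TYPE('a) x y \<longleftrightarrow> omega_power E0 (f x) (f y)" for x y
  proof
    assume "group_equiv TYPE('a) x y"
    then show "omega_power E0 (f x) (f y)"
      unfolding omega_power_def f_def r(2) group_equiv_def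
      using convergent_imp_right_Cauchy[OF _ H(1,2)] by blast
  next
    assume "omega_power E0 (f x) (f y)"
    then have cau: "\<exists>N. \<forall>m\<ge>N. \<forall>n\<ge>N. (x m - y m) - (x n - y n) \<in> H k" for k
      unfolding omega_power_def f_def r(2) by blast
    have "convergent (\<lambda>n. x n - y n)"
    proof (rule two_sided_Cauchy_convergent)
      fix U :: "'a set" assume U: "open U" "0 \<in> U"
      then obtain k where k: "H k \<subseteq> U" using base by blast
      obtain N where N: "\<forall>m\<ge>N. \<forall>n\<ge>N. (x m - y m) - (x n - y n) \<in> H k"
        using cau by blast
      then show "\<exists>N. \<forall>m\<ge>N. \<forall>n\<ge>N. (x m - y m) - (x n - y n) \<in> U"
        using k by blast
      have "- (x m - y m) + (x n - y n) \<in> U" if "m \<ge> N" "n \<ge> N" for m n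
      proof -
        \<comment> \<open>Normality turns the right Cauchy condition into the left one: this
          conjugation moves \<open>- (x m - y m)\<close> from the back to the front.\<close>
        have "- (x m - y m) + ((x n - y n) - (x m - y m)) - (- (x m - y m)) \<in> H k"
          using N that by (intro H(4)) blast
        then have "- (x m - y m) + (x n - y n) \<in> H k" by (simp only: group_add_normalize)
        then show ?thesis using k by blast
      qed
      then show "\<exists>N. \<forall>m\<ge>N. \<forall>n\<ge>N. - (x m - y m) + (x n - y n) \<in> U" by blast
    qed
    then show "group_equiv TYPE('a) x y" unfolding group_equiv_def .
  qed
  ultimately show ?thesis
    unfolding borel_reducible_def using borel_measurable_continuous_onI[of f] by blast
qed

section \<open>Lower bounds for equivalence relations of Polish groups\<close>

lemma borel_reducible_trans:
  assumes "E \<le>\<^sub>B F" "F \<le>\<^sub>B G"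
  shows "E \<le>\<^sub>B G"
proof -
  obtain f where f: "f \<in> measurable borel borel" "\<And>x y. E x y \<longleftrightarrow> F (f x) (f y)"
    using assms(1) unfolding borel_reducible_def by blast
  obtain g where g: "g \<in> measurable borel borel" "\<And>x y. F x y \<longleftrightarrow> G (g x) (g y)"
    using assms(2) unfolding borel_reducible_def by blast
  have "(\<lambda>x. g (f x)) \<in> measurable borel borel" using f(1) g(1) by (rule measurable_compose)
  moreover have "\<forall>x y. E x y \<longleftrightarrow> G (g (f x)) (g (f y))" using f(2) g(2) by simp
  ultimately show ?thesis
    unfolding borel_reducible_def by (intro bexI[of _ "\<lambda>x. g (f x)"])
qed

text \<open>Zeros at the even places force the limit of a convergent difference to be
  \<open>0\<close>, so convergence to \<open>0\<close> may stand in for convergence.\<close>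

lemma reducible_group_equivI:
  fixes u :: "'x::topological_space \<Rightarrow> nat \<Rightarrow> 'a::{topological_group_add, t2_space}"
  assumes cont: "\<And>n. continuous_on UNIV (\<lambda>x. u x n)"
    and iff: "\<And>x y. E x y \<longleftrightarrow> (\<lambda>n. u x n - u y n) \<longlonglongrightarrow> 0"
  shows "E \<le>\<^sub>B group_equiv TYPE('a)"
proof -
  define f where "f x n = (if even n then 0 else u x (n div 2))" for x n
  have "continuous_on UNIV (\<lambda>x. f x n)" for n
    unfolding f_def using cont by (cases "even n") simp_all
  then have "continuous_on UNIV f" by (rule continuous_on_coordinatewise_then_product)
  moreover have "E x y \<longleftrightarrow> group_equiv TYPE('a) (f x) (f y)" for x y
  proof
    assume "E x y"
    then have lim: "(\<lambda>n. u x n - u y n) \<longlonglongrightarrow> 0" by (simp add: iff)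
    have "(\<lambda>n. f x n - f y n) \<longlonglongrightarrow> 0"
    proof (rule topological_tendstoI)
      fix S :: "'a set" assume S: "open S" "0 \<in> S"
      then obtain N where N: "\<And>n. n \<ge> N \<Longrightarrow> u x n - u y n \<in> S"
        using topological_tendstoD[OF lim] unfolding eventually_sequentially by blast
      have "f x n - f y n \<in> S" if "n \<ge> 2 * N" for n
        using N[of "n div 2"] S(2) that by (auto simp: f_def)
      then show "eventually (\<lambda>n. f x n - f y n \<in> S) sequentially"
        unfolding eventually_sequentially by blast
    qed
    then show "group_equiv TYPE('a) (f x) (f y)" unfolding group_equiv_def convergent_def by blast
  next
    assume "group_equiv TYPE('a) (f x) (f y)"
    then obtain L where L: "(\<lambda>n. f x n - f y n) \<longlonglongrightarrow> L"
      unfolding group_equiv_def convergent_def by blast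
    have "(\<lambda>n. f x (2 * n) - f y (2 * n)) \<longlonglongrightarrow> L"
      using LIMSEQ_subseq_LIMSEQ[OF L, of "\<lambda>n. 2 * n"] by (simp add: strict_mono_def o_def)
    then have "L = 0" by (simp add: f_def LIMSEQ_const_iff)
    have "(\<lambda>n. f x (2 * n + 1) - f y (2 * n + 1)) \<longlonglongrightarrow> L"
      using LIMSEQ_subseq_LIMSEQ[OF L, of "\<lambda>n. 2 * n + 1"] by (simp add: strict_mono_def o_def)
    then show "E x y" by (simp add: f_def iff \<open>L = 0\<close>)
  qed
  ultimately show ?thesis
    unfolding borel_reducible_def using borel_measurable_continuous_onI[of f] by blast
qed

lemma discrete_E0_reducible:
  fixes a b :: "'a::{topological_group_add, t2_space}"
  assumes "discrete_space TYPE('a)" "a \<noteq> b"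
  shows "E0 \<le>\<^sub>B group_equiv TYPE('a)"
proof (rule reducible_group_equivI)
  define u where "u x n = (if x n then a - b else 0)" for x :: "nat \<Rightarrow> bool" and n
  show "continuous_on UNIV (\<lambda>x. u x n)" for n
    unfolding u_def by (intro continuous_on_discrete_compose[where g = "\<lambda>v. if v then a - b else 0"]
      continuous_on_product_coordinates)
  show "E0 x y \<longleftrightarrow> (\<lambda>n. u x n - u y n) \<longlonglongrightarrow> 0" for x y
  proof
    assume "E0 x y"
    then obtain m where "\<And>n. n > m \<Longrightarrow> x n = y n" unfolding E0_def by blast
    then have "eventually (\<lambda>n. 0 = u x n - u y n) sequentially"
      unfolding eventually_sequentially by (intro exI[of _ "Suc m"]) (simp add: u_def)
    then show "(\<lambda>n. u x n - u y n) \<longlonglongrightarrow> 0"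
      by (rule Lim_transform_eventually[OF tendsto_const])
  next
    assume lim: "(\<lambda>n. u x n - u y n) \<longlonglongrightarrow> 0"
    have "eventually (\<lambda>n. u x n - u y n \<in> {0}) sequentially"
      by (rule topological_tendstoD[OF lim]) (use assms(1) in \<open>simp_all add: discrete_space_def\<close>)
    then obtain N where N: "\<And>n. n \<ge> N \<Longrightarrow> u x n = u y n"
      unfolding eventually_sequentially by auto
    have "x n = y n" if "n \<ge> N" for n
      using N[OF that] assms(2) by (auto simp: u_def split: if_splits)
    then show "E0 x y" unfolding E0_def by (meson less_imp_le)
  qed
qed

text \<open>Nonzero elements \<open>g k\<close> tending to \<open>0\<close> mark the bits of column
  \<open>k\<close>. A difference in column \<open>k\<close> has value \<open>g k\<close> or
  \<open>- g k\<close>, which is bounded away from \<open>0\<close>, so convergence to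
  \<open>0\<close> allows only finitely many in each column; in late columns all differences are
  small anyway.\<close>

lemma omega_power_E0_reducible:
  assumes "\<not> discrete_space TYPE('a::{topological_group_add, first_countable_topology, t2_space})"
  shows "omega_power E0 \<le>\<^sub>B group_equiv TYPE('a)"
proof -
  have "\<not> open {0::'a}"
  proof
    assume op: "open {0::'a}"
    have "open {x}" for x :: 'a
    proof -
      have "open ((\<lambda>v. v - x) -` {0})" by (intro open_vimage op continuous_intros)
      moreover have "(\<lambda>v. v - x) -` {0} = {x}" by auto
      ultimately show ?thesis by simp
    qed
    then have "open (\<Union>x\<in>S. {x})" for S :: "'a set" by (intro open_UN ballI)
    then show False using assms by (simp add: discrete_space_def)
  qed
  obtain A :: "nat \<Rightarrow> 'a set" where A: "\<And>k. open (A k)" "\<And>k. 0 \<in> A k"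
      "\<And>S. open S \<Longrightarrow> 0 \<in> S \<Longrightarrow> eventually (\<lambda>k. A k \<subseteq> S) sequentially"
    using countable_basis_at_decseq[of "0::'a"] by blast
  have "\<forall>k. \<exists>g\<in>A k. g \<noteq> 0"
  proof
    fix k
    have "A k \<noteq> {0}" using A(1) \<open>\<not> open {0}\<close> by metis
    then show "\<exists>g\<in>A k. g \<noteq> 0" using A(2) by blast
  qed
  then obtain g where g: "\<And>k. g k \<in> A k" "\<And>k. g k \<noteq> 0" by metis
  define u where "u x j = (if x (fst (prod_decode j)) (snd (prod_decode j)) then g (fst (prod_decode j)) else 0)"
    for x :: "nat \<Rightarrow> nat \<Rightarrow> bool" and j
  have u: "u x (prod_encode (k, i)) = (if x k i then g k else 0)" for x k i
    by (simp add: u_def)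
  show ?thesis
  proof (rule reducible_group_equivI)
    show "continuous_on UNIV (\<lambda>x. u x n)" for n
      unfolding u_def
      by (intro continuous_on_discrete_compose[where g = "\<lambda>v. if v then g (fst (prod_decode n)) else 0"]
          continuous_on_product_then_coordinatewise[OF continuous_on_product_coordinates])
    show "omega_power E0 x y \<longleftrightarrow> (\<lambda>n. u x n - u y n) \<longlonglongrightarrow> 0" for x y
    proof
      assume lim: "(\<lambda>n. u x n - u y n) \<longlonglongrightarrow> 0"
      have "E0 (x k) (y k)" for k
      proof -
        have "open (- {g k, - g k})" by (intro open_Compl finite_imp_closed) simp
        moreover have "0 \<in> - {g k, - g k}" using g(2)[of k] by auto
        ultimately have "eventually (\<lambda>n. u x n - u y n \<in> - {g k, - g k}) sequentially"
          by (rule topological_tendstoD[OF lim])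
        then obtain J where J: "\<And>j. j \<ge> J \<Longrightarrow> u x j - u y j \<in> - {g k, - g k}"
          unfolding eventually_sequentially by blast
        have "x k i = y k i" if "i > J" for i
          using J[of "prod_encode (k, i)"] le_prod_encode_2[of i k] that
          by (auto simp: u split: if_splits)
        then show ?thesis unfolding E0_def by blast
      qed
      then show "omega_power E0 x y" unfolding omega_power_def by blast
    next
      assume "omega_power E0 x y"
      then have "\<forall>k. \<exists>m. \<forall>i>m. x k i = y k i" unfolding omega_power_def E0_def .
      then obtain M where M: "\<And>k i. i > M k \<Longrightarrow> x k i = y k i" by metis
      show "(\<lambda>n. u x n - u y n) \<longlonglongrightarrow> 0"
      proof (rule topological_tendstoI)
        fix U :: "'a set" assume U: "open U" "0 \<in> U"
        \<comment> \<open>The symmetric neighbourhood puts both \<open>g k\<close> and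
          \<open>- g k\<close> into \<open>U\<close> for late columns.\<close>
        have "open (U \<inter> uminus -` U)" by (intro open_Int open_vimage U continuous_intros)
        then obtain K where K: "\<And>k. k \<ge> K \<Longrightarrow> A k \<subseteq> U \<inter> uminus -` U"
          using A(3)[of "U \<inter> uminus -` U"] U(2) unfolding eventually_sequentially by auto
        have "finite (\<Union>k<K. (\<lambda>i. prod_encode (k, i)) ` {..M k})" by simp
        then obtain J where J: "\<And>j. j \<in> (\<Union>k<K. (\<lambda>i. prod_encode (k, i)) ` {..M k}) \<Longrightarrow> j \<le> J"
          unfolding finite_nat_set_iff_bounded_le by blast
        have "u x j - u y j \<in> U" if "j > J" for j
        proof -
          obtain k i where j: "j = prod_encode (k, i)" by (metis prod_decode_inverse surj_pair)
          show ?thesis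
          proof (cases "k < K")
            case True
            have "i > M k"
            proof (rule ccontr)
              assume "\<not> i > M k"
              then have "i \<in> {..M k}" by simp
              then have "j \<in> (\<Union>k<K. (\<lambda>i. prod_encode (k, i)) ` {..M k})"
                using True unfolding j by blast
              then have "j \<le> J" by (rule J)
              then show False using that by simp
            qed
            then show ?thesis using M U(2) by (simp add: j u)
          next
            case False
            then have "g k \<in> U" "- g k \<in> U" using K[of k] g(1)[of k] by auto
            then show ?thesis using U(2) by (simp add: j u)
          qed
        qed
        then show "eventually (\<lambda>n. u x n - u y n \<in> U) sequentially"
          unfolding eventually_sequentially by (meson Suc_le_eq)
      qed
    qed
  qed
qed

text \<open>The points reachable from \<open>0\<close> by finitely many steps in a symmetric
  neighbourhood \<open>V k\<close> form an open subgroup. If no open subgroup lies inside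
  \<open>U\<close>, this yields a chain \<open>p k\<close> that leaves \<open>U\<close>, and
  \<open>x k\<close> is read as a position on it.\<close>

lemma reducible_eq_plus_non_archimedean:
  assumes red: "group_equiv TYPE('a::{topological_group_add, first_countable_topology, t2_space}) \<le>\<^sub>B eq_plus"
  shows "non_archimedean TYPE('a)"
proof (rule ccontr)
  assume "\<not> non_archimedean TYPE('a)"
  then obtain U :: "'a set" where U: "open U" "0 \<in> U"
    and no: "\<And>H. open H \<Longrightarrow> add_subgroup H \<Longrightarrow> \<not> H \<subseteq> U"
    unfolding non_archimedean_def by blast
  obtain A :: "nat \<Rightarrow> 'a set" where A: "\<And>k. open (A k)" "\<And>k. 0 \<in> A k"
      "\<And>S. open S \<Longrightarrow> 0 \<in> S \<Longrightarrow> eventually (\<lambda>k. A k \<subseteq> S) sequentially"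
    using countable_basis_at_decseq[of "0::'a"] by blast
  define V where "V k = A k \<inter> uminus -` A k" for k
  have V: "open (V k)" "0 \<in> V k" "\<And>v. v \<in> V k \<Longrightarrow> - v \<in> V k" for k
    unfolding V_def using A(2) by (auto intro!: open_Int open_vimage A(1) continuous_intros)
  have path: "\<exists>p m. p 0 = 0 \<and> p m \<notin> U \<and> (\<forall>j<m. p (Suc j) - p j \<in> V k)" for k
  proof -
    \<comment> \<open>Right translation preserves \<open>R\<close>, and \<open>R\<close> is
      symmetric because \<open>V k\<close> is; hence the set reachable from \<open>0\<close> is a
      subgroup.\<close>
    define R where "R = {(p, q). q - p \<in> V k}"
    define H where "H = {p. (0, p) \<in> R\<^sup>*}"
    have trans: "(p + h, q + h) \<in> R\<^sup>*" if "(p, q) \<in> R\<^sup>*" for p q h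
      using that
    proof (induction rule: rtrancl_induct)
      case (step q r)
      have "(q + h, r + h) \<in> R"
        using step(2) by (simp add: R_def group_add_normalize del: add_uminus_conv_diff)
      then show ?case using step(3) by (rule rtrancl_into_rtrancl[rotated])
    qed simp
    have "sym R"
      unfolding R_def using V(3)[of _ k] by (auto intro!: symI) (metis minus_diff_eq)
    then have symR: "sym (R\<^sup>*)" by (rule sym_rtrancl)
    have "add_subgroup H"
      unfolding add_subgroup_def
    proof (intro conjI ballI)
      show "0 \<in> H" by (simp add: H_def)
    next
      fix x y assume "x \<in> H" "y \<in> H"
      then show "x + y \<in> H"
        unfolding H_def using trans[of 0 x y] by (auto intro: rtrancl_trans)
    next
      fix x assume "x \<in> H"
      then show "- x \<in> H"
        unfolding H_def using trans[of 0 x "- x"] symR by (auto dest: symD)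
    qed
    moreover have "open H"
    proof (subst open_subopen, intro ballI)
      fix x assume x: "x \<in> H"
      have "open ((\<lambda>y. y - x) -` V k)" by (intro open_vimage V(1) continuous_intros)
      moreover have "x \<in> (\<lambda>y. y - x) -` V k" using V(2) by simp
      moreover have "(\<lambda>y. y - x) -` V k \<subseteq> H"
        using x by (auto simp: H_def R_def intro: rtrancl_into_rtrancl)
      ultimately show "\<exists>T. open T \<and> x \<in> T \<and> T \<subseteq> H" by blast
    qed
    ultimately obtain q where q: "q \<in> H" "q \<notin> U" using no by blast
    then obtain m where "(0, q) \<in> R ^^ m" unfolding H_def using rtrancl_imp_relpow by blast
    then obtain p where "p 0 = 0" "p m = q" "\<forall>j<m. (p j, p (Suc j)) \<in> R"
      unfolding relpow_fun_conv by blast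
    then show ?thesis using q(2) by (intro exI[of _ p] exI[of _ m]) (simp add: R_def)
  qed
  then obtain p m where p: "\<And>k. p k 0 = 0" "\<And>k. p k (m k) \<notin> U"
      "\<And>k j. j < m k \<Longrightarrow> p k (Suc j) - p k j \<in> V k"
    by metis
  \<comment> \<open>The minimum with \<open>m k\<close> stops the walk at the end of the
    chain.\<close>
  define u where "u x k = p k (min (x k) (m k))" for x :: "nat \<Rightarrow> nat" and k
  define E where "E x y \<longleftrightarrow> (\<lambda>k. u x k - u y k) \<longlonglongrightarrow> 0" for x y
  have "E \<le>\<^sub>B group_equiv TYPE('a)"
  proof (rule reducible_group_equivI)
    show "continuous_on UNIV (\<lambda>x. u x n)" for n
      unfolding u_def by (intro continuous_on_discrete_compose[where g = "\<lambda>v. p n (min v (m n))"]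
        continuous_on_product_coordinates)
  qed (simp add: E_def)
  then have "E \<le>\<^sub>B eq_plus" using red by (rule borel_reducible_trans)
  moreover have "\<not> E \<le>\<^sub>B eq_plus"
  proof (rule not_reducible_eq_plus)
    fix x y :: "nat \<Rightarrow> nat" and N
    assume xy: "\<forall>k\<ge>N. y k = x k \<or> y k = Suc (x k)"
    \<comment> \<open>A unit step moves along at most one link of the chain, so the difference lies
      in \<open>V k\<close>; these sets shrink to \<open>0\<close>.\<close>
    have uV: "u x k - u y k \<in> V k" if "k \<ge> N" for k
    proof (cases "min (y k) (m k) = min (x k) (m k)")
      case True
      then show ?thesis using V(2) by (simp add: u_def)
    next
      case False
      then have "x k < m k" "min (x k) (m k) = x k" "min (y k) (m k) = Suc (x k)"
        using xy that by (auto simp: min_def split: if_splits)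
      then show ?thesis
        using V(3)[OF p(3)[of "x k" k]] by (simp add: u_def)
    qed
    show "E x y"
      unfolding E_def
    proof (rule topological_tendstoI)
      fix S :: "'a set" assume "open S" "0 \<in> S"
      then obtain K where K: "\<And>k. k \<ge> K \<Longrightarrow> A k \<subseteq> S"
        using A(3) unfolding eventually_sequentially by blast
      have "u x k - u y k \<in> S" if "k \<ge> max N K" for k
        using uV[of k] K[of k] that by (auto simp: V_def)
      then show "eventually (\<lambda>k. u x k - u y k \<in> S) sequentially"
        unfolding eventually_sequentially by blast
    qed
  next
    fix x y :: "nat \<Rightarrow> nat"
    assume inf: "infinite {k. x k = 0 \<and> y k = m k}"
    show "\<not> E x y"
    proof
      assume "E x y"
      then have lim: "(\<lambda>k. u x k - u y k) \<longlonglongrightarrow> 0" by (simp add: E_def)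
      \<comment> \<open>At opposite ends the difference is \<open>- p k (m k)\<close> with
        \<open>p k (m k)\<close> outside \<open>U\<close>, hence the neighbourhood formed by the
        inverses of \<open>U\<close>.\<close>
      have "eventually (\<lambda>k. u x k - u y k \<in> uminus -` U) sequentially"
        by (rule topological_tendstoD[OF lim]) (use U(2) in \<open>auto intro!: open_vimage U(1) continuous_intros\<close>)
      then obtain K where K: "\<And>k. k \<ge> K \<Longrightarrow> u x k - u y k \<in> uminus -` U"
        unfolding eventually_sequentially by blast
      obtain k where k: "k \<ge> K" "x k = 0" "y k = m k"
        using inf unfolding infinite_nat_iff_unbounded_le by blast
      then have "p k (m k) \<in> U" using K[OF k(1)] by (simp add: u_def p(1))
      then show False using p(2) by blast
    qed
  qed
  ultimately show False by blast
qed

section \<open>The three statements on \<open>E(G)\<close>\<close>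

lemma discrete_imp_countable:
  assumes "discrete_space TYPE('a::second_countable_topology)"
  shows "countable (UNIV :: 'a set)"
proof -
  obtain D :: "'a set" where D: "countable D" "\<And>X. open X \<Longrightarrow> X \<noteq> {} \<Longrightarrow> \<exists>d\<in>D. d \<in> X"
    using countable_dense_setE by blast
  have "x \<in> D" for x using D(2)[of "{x}"] assms by (simp add: discrete_space_def)
  then show ?thesis using D(1) by (metis UNIV_eq_I)
qed

lemma E0_reducible_imp_nontrivial:
  assumes "E0 \<le>\<^sub>B group_equiv TYPE('a::topological_group_add)"
  shows "\<exists>a b :: 'a. a \<noteq> b"
proof (rule ccontr)
  assume "\<not> (\<exists>a b :: 'a. a \<noteq> b)"
  then have all: "a = b" for a b :: 'a by blast
  obtain f :: "(nat \<Rightarrow> bool) \<Rightarrow> nat \<Rightarrow> 'a" where f: "\<And>x y. E0 x y \<longleftrightarrow> group_equiv TYPE('a) (f x) (f y)"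
    using assms unfolding borel_reducible_def by blast
  have "(\<lambda>n. f x n - f y n) = (\<lambda>_. 0)" for x y using all by blast
  then have "E0 (\<lambda>_. True) (\<lambda>_. False)"
    by (simp add: f group_equiv_def convergent_const)
  then show False unfolding E0_def by blast
qed

theorem theorem1p1:
  shows "((discrete_space TYPE('a::{topological_group_add, polish_space}) \<and>
            countable (UNIV :: 'a set) \<and> (\<exists>a b :: 'a. a \<noteq> b))
          \<longleftrightarrow> group_equiv TYPE('a) \<sim>\<^sub>B E0)
    \<and> (TSI TYPE('a) \<and> uncountable (UNIV :: 'a set) \<and> non_archimedean TYPE('a)
          \<longrightarrow> group_equiv TYPE('a) \<sim>\<^sub>B omega_power E0)
    \<and> (non_archimedean TYPE('a) \<longleftrightarrow> group_equiv TYPE('a) \<le>\<^sub>B eq_plus)"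
proof (intro conjI impI iffI)
  assume *: "discrete_space TYPE('a) \<and> countable (UNIV :: 'a set) \<and> (\<exists>a b :: 'a. a \<noteq> b)"
  then obtain a b :: 'a where "a \<noteq> b" by blast
  then show "group_equiv TYPE('a) \<sim>\<^sub>B E0"
    unfolding borel_bireducible_def
    using * discrete_reducible_E0 discrete_E0_reducible by blast
next
  assume "group_equiv TYPE('a) \<sim>\<^sub>B E0"
  then have red: "group_equiv TYPE('a) \<le>\<^sub>B E0" "E0 \<le>\<^sub>B group_equiv TYPE('a)"
    unfolding borel_bireducible_def by auto
  \<comment> \<open>If the group were not discrete, \<open>omega_power E0\<close> would reduce to
    \<open>E(G)\<close> and hence to \<open>E0\<close>.\<close>
  show "discrete_space TYPE('a)"
    using omega_power_E0_reducible borel_reducible_trans[OF _ red(1)] omega_power_E0_not_reducible_E0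
    by blast
  then show "countable (UNIV :: 'a set)" by (rule discrete_imp_countable)
  show "\<exists>a b :: 'a. a \<noteq> b" using red(2) by (rule E0_reducible_imp_nontrivial)
next
  assume *: "TSI TYPE('a) \<and> uncountable (UNIV :: 'a set) \<and> non_archimedean TYPE('a)"
  then have "\<not> discrete_space TYPE('a)" using discrete_imp_countable by blast
  then show "group_equiv TYPE('a) \<sim>\<^sub>B omega_power E0"
    unfolding borel_bireducible_def
    using * TSI_non_archimedean_reducible omega_power_E0_reducible by blast
next
  show "group_equiv TYPE('a) \<le>\<^sub>B eq_plus" if "non_archimedean TYPE('a)"
    using that by (rule non_archimedean_reducible_eq_plus)
  show "non_archimedean TYPE('a)" if "group_equiv TYPE('a) \<le>\<^sub>B eq_plus"
    using that by (rule reducible_eq_plus_non_archimedean)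
qed

end
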